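(* Let $n,t$ be positive integers and let $G$ be a $(P_6+tP_2)$-saturated graph on $n$ vertices. Let $Q = Q_1+Q_2+\cdots+Q_k$ be the union of all nontrivial (i.e. with at least two vertices) connected components $Q_1,\dots,Q_k$ of $G$. Suppose $|V(Q)|\geq 2t+6$, $\delta(Q)\geq 2$, and for each $1\le i\le k$, $|V(Q_i)|\geq 6$ and $Q_i$ is not isomorphic to any book $B_m$ nor to any fan $F_m$. Then: (1) $G$ is $(P_4+(t+1)P_2)$-saturated; (2) if $G$ has at least one isolated vertex, then $|E(G)| > 3t+18$.
   Context: All graphs are finite and simple. For graphs $G,H$, $G+H$ denotes the disjoint union and $tG$ the disjoint union of $t$ copies of $G$; $P_k$ is the path on $k$ vertices; $\delta(Q)$ is the minimum degree. A graph $G$ is $H$-saturated if $G$ contains no subgraph isomorphic to $H$, but $G+e$ contains a subgraph isomorphic to $H$ for every edge $e$ of the complement of $G$. The book $B_m$ is the graph of $m$ triangles sharing one common edge; the fan $F_m$ is the graph of $m$ triangles sharing one common vertex and otherwise disjoint. *)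

theory Defs
  imports Main
begin

section \<open>Finite simple graphs\<close>

record 'a graph =
  verts :: "'a set"
  edges :: "'a set set"

definition simple_graph :: "'a graph \<Rightarrow> bool" where
  "simple_graph G \<longleftrightarrow> finite (verts G) \<and> (\<forall>e\<in>edges G. e \<subseteq> verts G \<and> card e = 2)"

definition subgraph :: "'a graph \<Rightarrow> 'a graph \<Rightarrow> bool" where
  "subgraph S G \<longleftrightarrow> simple_graph S \<and> verts S \<subseteq> verts G \<and> edges S \<subseteq> edges G"

definition isomorphic :: "'a graph \<Rightarrow> 'b graph \<Rightarrow> bool" where
  "isomorphic G H \<longleftrightarrow>
     (\<exists>f. bij_betw f (verts G) (verts H) \<and>
          (\<forall>u\<in>verts G. \<forall>v\<in>verts G. {u, v} \<in> edges G \<longleftrightarrow> {f u, f v} \<in> edges H))"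

definition contains_copy :: "'a graph \<Rightarrow> 'b graph \<Rightarrow> bool" where
  "contains_copy G H \<longleftrightarrow> (\<exists>S. subgraph S G \<and> isomorphic S H)"

definition complement :: "'a graph \<Rightarrow> 'a graph" where
  "complement G = \<lparr>verts = verts G, edges = {e. e \<subseteq> verts G \<and> card e = 2 \<and> e \<notin> edges G}\<rparr>"

definition add_edge :: "'a graph \<Rightarrow> 'a set \<Rightarrow> 'a graph" where
  "add_edge G e = \<lparr>verts = verts G, edges = insert e (edges G)\<rparr>"

definition saturated :: "'b graph \<Rightarrow> 'a graph \<Rightarrow> bool" where
  "saturated H G \<longleftrightarrow>
     \<not> contains_copy G H \<and> (\<forall>e\<in>edges (complement G). contains_copy (add_edge G e) H)"

definition degree :: "'a graph \<Rightarrow> 'a \<Rightarrow> nat" where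
  "degree G v = card {e \<in> edges G. v \<in> e}"

text \<open>Meaningful for finite graphs with at least one vertex only.\<close>

definition min_degree :: "'a graph \<Rightarrow> nat" where
  "min_degree G = Min (degree G ` verts G)"

definition isolated :: "'a graph \<Rightarrow> 'a \<Rightarrow> bool" where
  "isolated G v \<longleftrightarrow> v \<in> verts G \<and> degree G v = 0"

definition graph_Union :: "'a graph set \<Rightarrow> 'a graph" where
  "graph_Union \<G> = \<lparr>verts = (\<Union>G\<in>\<G>. verts G), edges = (\<Union>G\<in>\<G>. edges G)\<rparr>"


section \<open>Connected components\<close>

definition adjacency :: "'a graph \<Rightarrow> ('a \<times> 'a) set" where
  "adjacency G = {(u, v). {u, v} \<in> edges G}"

definition induced :: "'a graph \<Rightarrow> 'a set \<Rightarrow> 'a graph" where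
  "induced G S = \<lparr>verts = verts G \<inter> S, edges = {e \<in> edges G. e \<subseteq> S}\<rparr>"

definition components :: "'a graph \<Rightarrow> 'a graph set" where
  "components G = (\<lambda>v. induced G ((adjacency G)\<^sup>* `` {v})) ` verts G"

definition nontrivial_components :: "'a graph \<Rightarrow> 'a graph set" where
  "nontrivial_components G = {C \<in> components G. card (verts C) \<ge> 2}"

text \<open>Distinct components of a graph are vertex-disjoint, so the union of the nontrivial ones
  inside the graph is also their disjoint union.\<close>

definition nontrivial_part :: "'a graph \<Rightarrow> 'a graph" where
  "nontrivial_part G = graph_Union (nontrivial_components G)"


section \<open>Disjoint unions, paths, books and fans\<close>

definition disjoint_union :: "'a graph \<Rightarrow> 'b graph \<Rightarrow> ('a + 'b) graph" (infixl "\<oplus>" 65) where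
  "G \<oplus> H = \<lparr>verts = Inl ` verts G \<union> Inr ` verts H,
            edges = (`) Inl ` edges G \<union> (`) Inr ` edges H\<rparr>"

definition copies :: "nat \<Rightarrow> 'a graph \<Rightarrow> (nat \<times> 'a) graph" where
  "copies t G = \<lparr>verts = {..<t} \<times> verts G,
                 edges = (\<Union>i<t. (`) (Pair i) ` edges G)\<rparr>"

text \<open>\<open>path k\<close> is the path on \<open>k\<close> vertices (not on \<open>k\<close> edges).\<close>

definition path :: "nat \<Rightarrow> nat graph" where
  "path k = \<lparr>verts = {..<k}, edges = {{i, Suc i} |i. Suc i < k}\<rparr>"

definition triangle :: "'a \<Rightarrow> 'a \<Rightarrow> 'a \<Rightarrow> 'a graph" where
  "triangle a b c = \<lparr>verts = {a, b, c}, edges = {{a, b}, {a, c}, {b, c}}\<rparr>"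

text \<open>The common edge of the triangles of a book is \<open>{0, 1}\<close>, and the common vertex of the
  triangles of a fan is \<open>0\<close>. Both are intended for \<open>m \<ge> 1\<close> only; they are empty for \<open>m = 0\<close>.\<close>

definition book :: "nat \<Rightarrow> nat graph" where
  "book m = graph_Union ((\<lambda>i. triangle 0 1 (i + 2)) ` {..<m})"

definition fan :: "nat \<Rightarrow> nat graph" where
  "fan m = graph_Union ((\<lambda>i. triangle 0 (2 * i + 1) (2 * i + 2)) ` {..<m})"

end

theory Submission
  imports Defs
begin

text \<open>Part (1) amounts to the claim that \<open>G\<close> has no matching of size \<open>t + 3\<close>: otherwise no
  maximum matching has three edges on an alternating \<open>P\<^sub>6\<close>, and this condition, used for several
  maximum matchings that differ by one or two exchanges, forces each component to be a fan or to consist of two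
  vertices \<open>p\<close>, \<open>q\<close> together with further vertices whose neighbourhood is exactly \<open>{p, q}\<close>. The latter
  is a book, unless \<open>p\<close> and \<open>q\<close> are not adjacent, and then adding \<open>{p, q}\<close> creates no new copy
  of \<open>P\<^sub>6 + tP\<^sub>2\<close>. For part (2), with an isolated vertex present, saturation and the argument of
  Gallai's lemma make all components complete, so that minimum degrees give the edge bound.\<close>

section \<open>Copies of a path with a matching\<close>

text \<open>\<open>P_6 + tP_2\<close> and \<open>P_4 + (t+1)P_2\<close> both have a perfect matching
  with \<open>t + 3\<close> edges, and the first contains the second. Hence a copy of the first
  created by a new edge already gives a copy of the second, and part (1) only has to exclude copies
  inside \<open>G\<close> itself; a bound of \<open>t + 2\<close> on all matchings does this. The
  obstacle is that a matching with \<open>t + 3\<close> edges may be spread out so that no two or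
  three of its edges are joined to a path. Three hypotheses remove it. Minimum degree two gives
  every vertex on an edge a second neighbour, which has to lie in one of very few places. Component
  size at least 6 leaves two vertices outside any two matching edges, and two such unmatched
  vertices invite augmenting paths, which maximality excludes. The two shapes of a component arise
  from the question whether a third matching edge is attached to two adjacent ones.\<close>

definition matching :: "'a set set \<Rightarrow> 'a set set \<Rightarrow> bool" where
  "matching E M \<longleftrightarrow> M \<subseteq> E \<and> pairwise disjnt M"

text \<open>This is a copy of \<open>P_k + sP_2\<close> expressed through the edge set alone, so
  that adding an edge to the graph becomes a plain \<open>insert\<close>.\<close>

definition path_matching :: "'a set set \<Rightarrow> nat \<Rightarrow> nat \<Rightarrow> bool" where
  "path_matching E k s \<longleftrightarrow> (\<exists>p M. inj_on p {..<k} \<and> (\<forall>i. Suc i < k \<longrightarrow> {p i, p (Suc i)} \<in> E) \<and>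
     matching E M \<and> card M = s \<and> p ` {..<k} \<inter> \<Union>M = {})"

section \<open>Subgraph copies as injective edge-preserving maps\<close>

lemma contains_copyD:
  assumes "contains_copy G H" "simple_graph H"
  obtains f where "inj_on f (verts H)" "\<And>e. e \<in> edges H \<Longrightarrow> f ` e \<in> edges G"
proof -
  obtain S g where S: "subgraph S G" and g: "bij_betw g (verts S) (verts H)"
    and ge: "\<And>u v. u \<in> verts S \<Longrightarrow> v \<in> verts S \<Longrightarrow> {u, v} \<in> edges S \<longleftrightarrow> {g u, g v} \<in> edges H"
    using assms(1) unfolding contains_copy_def isomorphic_def by blast
  define f where "f = inv_into (verts S) g"
  have bf: "bij_betw f (verts H) (verts S)"
    unfolding f_def using g by (rule bij_betw_inv_into)
  have "f ` e \<in> edges G" if e: "e \<in> edges H" for e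
  proof -
    from e assms(2) have "card e = 2" "e \<subseteq> verts H" by (auto simp: simple_graph_def)
    then obtain u v where uv: "e = {u, v}" "u \<in> verts H" "v \<in> verts H" by (auto simp: card_2_iff)
    have "g (f u) = u" "g (f v) = v" "f u \<in> verts S" "f v \<in> verts S"
      using uv g bf by (auto simp: f_def bij_betw_inv_into_right bij_betwE)
    with ge[of "f u" "f v"] e uv have "{f u, f v} \<in> edges S" by simp
    with S uv show ?thesis by (auto simp: subgraph_def)
  qed
  with bf show ?thesis by (auto simp: bij_betw_def intro: that)
qed

text \<open>\<open>isomorphic\<close> asks for an equivalence on all pairs of vertices, but the
  subgraph may drop edges of \<open>G\<close>. Taking for it exactly the image of \<open>H\<close>
  makes an injective edge-preserving map sufficient.\<close>

lemma contains_copyI: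
  assumes H: "simple_graph H" and inj: "inj_on f (verts H)" and sub: "f ` verts H \<subseteq> verts G"
    and edg: "\<And>e. e \<in> edges H \<Longrightarrow> f ` e \<in> edges G"
  shows "contains_copy G H"
proof -
  define S where "S = \<lparr>verts = f ` verts H, edges = (`) f ` edges H\<rparr>"
  have He: "e \<subseteq> verts H" "card e = 2" if "e \<in> edges H" for e
    using H that by (auto simp: simple_graph_def)
  have cf: "card (f ` e) = 2" if "e \<in> edges H" for e
    using He[OF that] inj by (metis card_image inj_on_subset)
  have "subgraph S G"
    unfolding subgraph_def simple_graph_def
  proof (intro conjI ballI)
    show "finite (verts S)" using H by (simp add: S_def simple_graph_def)
    show "verts S \<subseteq> verts G" using sub by (simp add: S_def)
    show "edges S \<subseteq> edges G" using edg by (auto simp: S_def)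
    fix e assume "e \<in> edges S"
    then obtain e' where e': "e' \<in> edges H" "e = f ` e'" by (auto simp: S_def)
    show "card e = 2" using e' cf by simp
    show "e \<subseteq> verts S" using e' He(1)[of e'] by (auto simp: S_def)
  qed
  moreover have "isomorphic S H"
    unfolding isomorphic_def
  proof (intro exI conjI ballI)
    show "bij_betw (inv_into (verts H) f) (verts S) (verts H)"
      unfolding S_def using inj by (simp add: bij_betw_inv_into inj_on_imp_bij_betw)
    fix x y assume "x \<in> verts S" "y \<in> verts S"
    then obtain u v where uv: "u \<in> verts H" "v \<in> verts H" "x = f u" "y = f v"
      by (auto simp: S_def)
    have "f ` e = f ` {u, v} \<longleftrightarrow> e = {u, v}" if "e \<in> edges H" for e
      using He(1)[OF that] uv inj by (intro inj_on_image_eq_iff) auto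
    then have "f ` {u, v} \<in> edges S \<longleftrightarrow> {u, v} \<in> edges H"
      unfolding S_def by (metis (no_types, lifting) graph.select_convs(2) imageE imageI)
    then show "{x, y} \<in> edges S \<longleftrightarrow> {inv_into (verts H) f x, inv_into (verts H) f y} \<in> edges H"
      using uv inj by simp
  qed
  ultimately show ?thesis by (auto simp: contains_copy_def)
qed

lemma simple_graph_path: "simple_graph (path k)"
  by (auto simp: simple_graph_def path_def)

lemma simple_graph_copies:
  assumes "simple_graph H"
  shows "simple_graph (copies s H)"
proof -
  have "card (Pair i ` e) = card e" for i :: nat and e :: "'a set"
    by (rule card_image) (auto simp: inj_on_def)
  then show ?thesis using assms by (auto simp: simple_graph_def copies_def)
qed

lemma simple_graph_disjoint_union:
  assumes "simple_graph G" "simple_graph H"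
  shows "simple_graph (G \<oplus> H)"
proof -
  have "card (Inl ` e :: ('a + 'b) set) = card e" for e by (rule card_image) simp
  moreover have "card (Inr ` e :: ('a + 'b) set) = card e" for e by (rule card_image) simp
  moreover have "(Inl ` e :: ('a + 'b) set) \<subseteq> verts (G \<oplus> H)" if "e \<in> edges G" for e
    using assms that by (auto simp: simple_graph_def disjoint_union_def)
  moreover have "(Inr ` e :: ('a + 'b) set) \<subseteq> verts (G \<oplus> H)" if "e \<in> edges H" for e
    using assms that unfolding simple_graph_def disjoint_union_def by fastforce
  moreover have "finite (verts (G \<oplus> H))"
    using assms by (auto simp: simple_graph_def disjoint_union_def)
  moreover have "edges (G \<oplus> H) = (`) Inl ` edges G \<union> (`) Inr ` edges H"
    by (simp add: disjoint_union_def)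
  ultimately show ?thesis
    using assms unfolding simple_graph_def by (metis (no_types, lifting) UnE imageE)
qed

section \<open>The forest of one path and \<open>s\<close> single edges\<close>

lemma edges_path: "edges (path k) = {{i, Suc i} |i. Suc i < k}"
  by (simp add: path_def)

lemma edges_path_2: "edges (path 2) = {{0, 1}}"
  by (auto simp: path_def less_Suc_eq numeral_2_eq_2)

lemma image_Collect_ex: "f ` {g i |i. P i} = {f (g i) |i. P i}"
  by blast

lemma edges_linear_forest:
  "edges (path k \<oplus> copies s (path 2)) =
    {{Inl i, Inl (Suc i)} |i. Suc i < k} \<union> {{Inr (i, 0), Inr (i, 1)} |i. i < s}"
proof -
  have "edges (copies s (path 2)) = {{(i, 0), (i, 1)} |i. i < s}"
    unfolding copies_def edges_path_2 by auto
  then show ?thesis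
    by (simp add: disjoint_union_def edges_path image_Collect_ex del: One_nat_def)
qed

lemma verts_linear_forest:
  "verts (path k \<oplus> copies s (path 2)) = Inl ` {..<k} \<union> Inr ` ({..<s} \<times> {..<2})"
  by (simp add: disjoint_union_def copies_def path_def)

text \<open>With \<open>k \<ge> 2\<close> every index of the path lies on one of its edges, which
  places its image in \<open>verts K\<close>; \<open>path_matching\<close> by itself speaks of edges
  only.\<close>

lemma contains_copy_linear_forest:
  assumes K: "simple_graph K" and k: "k \<ge> 2"
  shows "contains_copy K (path k \<oplus> copies s (path 2)) \<longleftrightarrow> path_matching (edges K) k s"
    (is "contains_copy K ?H \<longleftrightarrow> _")
proof
  have H: "simple_graph ?H"
    by (intro simple_graph_disjoint_union simple_graph_copies simple_graph_path)
  show "path_matching (edges K) k s" if copy: "contains_copy K ?H"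
  proof -
    obtain f where inj: "inj_on f (verts ?H)" and f: "\<And>e. e \<in> edges ?H \<Longrightarrow> f ` e \<in> edges K"
      using contains_copyD[OF copy H] by blast
    have inj': "\<And>x y. x \<in> verts ?H \<Longrightarrow> y \<in> verts ?H \<Longrightarrow> f x = f y \<longleftrightarrow> x = y"
      using inj by (auto simp: inj_on_def)
    define p where "p i = f (Inl i)" for i
    define h where "h i = {f (Inr (i, 0)), f (Inr (i, 1))}" for i
    have hdis: "disjnt (h i) (h j)" if "i < s" "j < s" "i \<noteq> j" for i j
      using that by (auto simp: h_def disjnt_def inj' verts_linear_forest image_iff)
    have hinj: "inj_on h {..<s}"
      using hdis by (fastforce simp: inj_on_def h_def disjnt_def)
    show ?thesis
      unfolding path_matching_def
    proof (intro exI conjI allI impI)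
      show "inj_on p {..<k}"
        by (auto simp: inj_on_def p_def inj' verts_linear_forest)
      show "{p i, p (Suc i)} \<in> edges K" if "Suc i < k" for i
        using that f[of "{Inl i, Inl (Suc i)}"] by (auto simp: p_def edges_linear_forest)
      have "h i \<in> edges K" if "i < s" for i
        using that f[of "{Inr (i, 0), Inr (i, 1)}"] by (auto simp: h_def edges_linear_forest)
      then show "matching (edges K) (h ` {..<s})"
        using hdis by (auto simp: matching_def pairwise_def)
      show "card (h ` {..<s}) = s"
        using hinj by (simp add: card_image)
      show "p ` {..<k} \<inter> \<Union> (h ` {..<s}) = {}"
        by (auto simp: p_def h_def inj' verts_linear_forest image_iff)
    qed
  qed
  show "contains_copy K ?H" if linear: "path_matching (edges K) k s"
  proof -
    obtain p M where p: "inj_on p {..<k}" "\<And>i. Suc i < k \<Longrightarrow> {p i, p (Suc i)} \<in> edges K"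
      and M: "matching (edges K) M" "card M = s" "p ` {..<k} \<inter> \<Union>M = {}"
      using linear unfolding path_matching_def by blast
    have Ke: "e \<subseteq> verts K" "card e = 2" if "e \<in> edges K" for e
      using K that by (auto simp: simple_graph_def)
    have "finite (edges K)"
      using K by (auto simp: simple_graph_def intro: finite_subset[of _ "Pow (verts K)"])
    then have "finite M" using M(1) by (auto simp: matching_def intro: finite_subset)
    then obtain h where h: "bij_betw h {..<s} M"
      using M(2) ex_bij_betw_nat_finite[of M] by (auto simp: atLeast0LessThan)
    have hM: "h i \<in> M" if "i < s" for i using h that by (auto simp: bij_betw_def)
    have "\<forall>i. \<exists>l r. i < s \<longrightarrow> h i = {l, r} \<and> l \<noteq> r"
    proof
      fix i
      show "\<exists>l r. i < s \<longrightarrow> h i = {l, r} \<and> l \<noteq> r"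
      proof (cases "i < s")
        case True
        then have "card (h i) = 2" using hM Ke(2) M(1) by (auto simp: matching_def)
        then show ?thesis unfolding card_2_iff by blast
      qed simp
    qed
    then obtain l r where lr: "\<And>i. i < s \<Longrightarrow> h i = {l i, r i} \<and> l i \<noteq> r i" by metis
    have hdis: "disjnt (h i) (h j)" if "i < s" "j < s" "i \<noteq> j" for i j
    proof -
      have "h i \<noteq> h j" using that h by (auto simp: bij_betw_def inj_on_def)
      then show ?thesis using that hM M(1) by (auto simp: matching_def pairwise_def)
    qed
    define f where "f = case_sum p (\<lambda>(i, j). if j = (0::nat) then l i else r i)"
    show ?thesis
    proof (rule contains_copyI[OF H, of f])
      have pM: "p i \<noteq> l j" "p i \<noteq> r j" if "i < k" "j < s" for i j
      proof -
        have "p i \<in> p ` {..<k}" "h j \<in> M" "h j = {l j, r j}" using that hM lr by auto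
        with M(3) show "p i \<noteq> l j" "p i \<noteq> r j" by auto
      qed
      have ne: "l i \<noteq> l j" "l i \<noteq> r j" "r i \<noteq> r j" if "i < s" "j < s" "i \<noteq> j" for i j
        using hdis[OF that] lr[of i] lr[of j] that by (auto simp: disjnt_def)
      show "inj_on f (verts ?H)"
        unfolding verts_linear_forest inj_on_Un
      proof (intro conjI)
        show "inj_on f (Inl ` {..<k})" using p(1) by (auto simp: inj_on_def f_def)
        show "inj_on f (Inr ` ({..<s} \<times> {..<2}))"
        proof (rule inj_onI)
          fix x y assume "x \<in> Inr ` ({..<s} \<times> {..<2::nat})" "y \<in> Inr ` ({..<s} \<times> {..<2::nat})"
            and eq: "f x = f y"
          then obtain i j i' j' where xy: "x = Inr (i, j)" "y = Inr (i', j')"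
            "i < s" "i' < s" "j < 2" "j' < 2" by auto
          have "i = i'"
          proof (rule ccontr)
            assume "i \<noteq> i'"
            with ne[of i i'] ne[of i' i] eq xy show False by (auto simp: f_def split: if_splits)
          qed
          with eq xy lr[of i] show "x = y"
            by (auto simp: f_def less_2_cases_iff split: if_splits)
        qed
        show "f ` (Inl ` {..<k} - Inr ` ({..<s} \<times> {..<2})) \<inter>
          f ` (Inr ` ({..<s} \<times> {..<2}) - Inl ` {..<k}) = {}"
          using pM by (auto simp: f_def split: if_splits)
      qed
      have "p i \<in> verts K" if ik: "i < k" for i
      proof (cases "Suc i < k")
        case True
        then show ?thesis using p(2) Ke(1) by blast
      next
        case False
        then obtain j where "i = Suc j" "Suc j < k" using ik k by (cases i) auto
        then show ?thesis using p(2) Ke(1) by blast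
      qed
      moreover have "l i \<in> verts K \<and> r i \<in> verts K" if "i < s" for i
        using Ke(1) hM[OF that] M(1) lr[OF that] by (auto simp: matching_def)
      ultimately show "f ` verts ?H \<subseteq> verts K"
        by (auto simp: verts_linear_forest f_def)
      show "f ` e \<in> edges K" if e: "e \<in> edges ?H" for e
      proof -
        consider i where "e = {Inl i, Inl (Suc i)}" "Suc i < k"
          | i where "e = {Inr (i, 0), Inr (i, 1)}" "i < s"
          using e by (auto simp: edges_linear_forest)
        then show ?thesis
        proof cases
          case 1
          then show ?thesis using p(2) by (simp add: f_def)
        next
          case 2
          then show ?thesis using hM[of i] M(1) lr[of i] by (auto simp: f_def matching_def)
        qed
      qed
    qed
  qed
qed

section \<open>Maximum matchings\<close>

lemma matching_same:
  "\<lbrakk>matching E M; A \<in> M; B \<in> M; x \<in> A; x \<in> B\<rbrakk> \<Longrightarrow> A = B"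
  by (auto simp: matching_def pairwise_def disjnt_def)

text \<open>Whatever \<open>B\<close> touches of \<open>M\<close> is covered by \<open>A\<close>, so
  \<open>B\<close> fits beside the rest. The condition \<open>{} \<notin> E\<close> is needed for
  the count: the empty set is disjoint from itself and could belong to both \<open>M - A\<close> and
  \<open>B\<close>.\<close>

lemma matching_exchange:
  assumes M: "matching E M" and A: "A \<subseteq> M" and B: "matching E B"
    and sub: "\<Union>B \<inter> \<Union>M \<subseteq> \<Union>A" and E: "finite E" "{} \<notin> E"
  shows "matching E (M - A \<union> B)" "card (M - A \<union> B) = card M - card A + card B"
proof -
  have dis: "disjnt x y" if x: "x \<in> M - A" and y: "y \<in> B" for x y
  proof (rule ccontr)
    assume "\<not> disjnt x y"
    then obtain v where v: "v \<in> x" "v \<in> y" by (auto simp: disjnt_def)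
    with x y sub obtain a where a: "a \<in> A" "v \<in> a" by blast
    have "x = a" by (rule matching_same[OF M]) (use a v x A in auto)
    with a x show False by simp
  qed
  show "matching E (M - A \<union> B)"
    using M B dis by (auto simp: matching_def pairwise_def disjnt_sym)
  have "(M - A) \<inter> B = {}"
    using dis B E(2) by (fastforce simp: matching_def disjnt_def)
  moreover have "finite M" "finite B"
    using M B E(1) by (auto simp: matching_def intro: finite_subset)
  ultimately show "card (M - A \<union> B) = card M - card A + card B"
    using A by (simp add: card_Un_disjoint card_Diff_subset finite_subset)
qed

section \<open>Reachability along an edge set\<close>

lemma edge_reachable_step:
  "x \<in> {(u, v). {u, v} \<in> E}\<^sup>* `` {r} \<Longrightarrow> {x, y} \<in> E \<Longrightarrow> y \<in> {(u, v). {u, v} \<in> E}\<^sup>* `` {r}"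
  by (auto intro: rtrancl.rtrancl_into_rtrancl)

lemma edge_reachable_eq:
  assumes "b \<in> {(u, v). {u, v} \<in> E}\<^sup>* `` {r}"
  shows "{(u, v). {u, v} \<in> E}\<^sup>* `` {b} = {(u, v). {u, v} \<in> E}\<^sup>* `` {r}"
proof -
  let ?R = "{(u, v). {u, v} \<in> E}"
  have "sym (?R\<^sup>*)"
    by (rule sym_rtrancl) (auto simp: sym_def insert_commute)
  then have "(r, b) \<in> ?R\<^sup>*" "(b, r) \<in> ?R\<^sup>*" using assms by (auto dest: symD)
  then show ?thesis by (auto intro: rtrancl_trans)
qed

lemma edge_reachable_subset:
  assumes "r \<in> W" "\<And>x y. x \<in> W \<Longrightarrow> {x, y} \<in> E \<Longrightarrow> y \<in> W"
  shows "{(u, v). {u, v} \<in> E}\<^sup>* `` {r} \<subseteq> W"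
proof
  fix x assume "x \<in> {(u, v). {u, v} \<in> E}\<^sup>* `` {r}"
  then have "(r, x) \<in> {(u, v). {u, v} \<in> E}\<^sup>*" by simp
  then show "x \<in> W" by induction (use assms in auto)
qed

lemma two_disjoint_doubletons:
  assumes "a \<noteq> c" "a \<noteq> d" "b \<noteq> c" "b \<noteq> d"
  shows "pairwise disjnt {{a, b}, {c, d}}" "card {{a, b}, {c, d}} = 2"
proof -
  have "disjnt {a, b} {c, d}" "disjnt {c, d} {a, b}" using assms by (auto simp: disjnt_def)
  then show "pairwise disjnt {{a, b}, {c, d}}" by (auto simp: pairwise_def)
  show "card {{a, b}, {c, d}} = 2" using assms by (auto simp: card_2_iff doubleton_eq_iff)
qed

text \<open>\<open>\<nu>\<close> is assumed to be an upper bound only. That it is attained enters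
  through \<open>mm\<close>, by way of the matching handed to each lemma, so the locale also fits a
  bound that is known from elsewhere.\<close>

locale max_matchings =
  fixes E :: "'a set set" and \<nu> :: nat
  assumes finite_E: "finite E" and card_E: "e \<in> E \<Longrightarrow> card e = 2"
    and card_le: "matching E M \<Longrightarrow> card M \<le> \<nu>"
begin

definition mm :: "'a set set \<Rightarrow> bool" where
  "mm M \<longleftrightarrow> matching E M \<and> card M = \<nu>"

lemma empty_notin: "{} \<notin> E"
  using card_E by fastforce

lemma E_neq: "{u, v} \<in> E \<Longrightarrow> u \<noteq> v"
  using card_E by fastforce

lemma E_sym: "{u, v} \<in> E \<Longrightarrow> {v, u} \<in> E"
  by (simp add: insert_commute)

lemma mm_E: "mm M \<Longrightarrow> e \<in> M \<Longrightarrow> e \<in> E"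
  by (auto simp: mm_def matching_def)

lemma mm_same: "\<lbrakk>mm M; A \<in> M; B \<in> M; x \<in> A; x \<in> B\<rbrakk> \<Longrightarrow> A = B"
  by (metis mm_def matching_same)

lemma finite_mm: "mm M \<Longrightarrow> finite M"
  unfolding mm_def matching_def using finite_E finite_subset by blast

lemma mm_edgeE:
  assumes "mm M" "x \<in> \<Union>M"
  obtains y where "{x, y} \<in> M" "x \<noteq> y"
proof -
  obtain e where e: "e \<in> M" "x \<in> e" using assms by blast
  with assms have "card e = 2" using card_E mm_E by blast
  then obtain a b where "e = {a, b}" "a \<noteq> b" by (auto simp: card_2_iff)
  with e that[of a] that[of b] show thesis by (auto simp: insert_commute)
qed

text \<open>The common source of the augmentations and switches below: a larger replacement
  contradicts maximality, an equally large one yields a new maximum matching.\<close>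

lemma mm_exchange:
  assumes M: "mm M" and A: "A \<subseteq> M" and B: "B \<subseteq> E" "pairwise disjnt B"
    and sub: "\<Union>B \<inter> \<Union>M \<subseteq> \<Union>A"
  shows "card A < card B \<Longrightarrow> False" "card A = card B \<Longrightarrow> mm (M - A \<union> B)"
proof -
  have mB: "matching E B" using B by (simp add: matching_def)
  have mM: "matching E M" "card M = \<nu>" using M by (auto simp: mm_def)
  note ex = matching_exchange[OF mM(1) A mB sub finite_E empty_notin]
  have cA: "card A \<le> card M" using A finite_mm[OF M] by (rule card_mono[rotated])
  show False if "card A < card B" using card_le[OF ex(1)] ex(2) cA that mM(2) by linarith
  show "mm (M - A \<union> B)" if "card A = card B" using ex cA that mM(2) by (simp add: mm_def)
qed

lemma mm_covers:
  assumes "mm M" "{u, v} \<in> E" "u \<notin> \<Union>M" "v \<notin> \<Union>M"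
  shows False
  using mm_exchange(1)[of M "{}" "{{u, v}}"] assms by (auto simp: pairwise_def)

text \<open>Otherwise \<open>u\<close>, \<open>a\<close>, \<open>b\<close>, \<open>v\<close> is an
  augmenting path. The exception \<open>u = v\<close> closes it to a triangle.\<close>

lemma augment1:
  assumes "mm M" "{a, b} \<in> M" "u \<notin> \<Union>M" "v \<notin> \<Union>M" "{u, a} \<in> E" "{b, v} \<in> E"
  shows "u = v"
proof (rule ccontr)
  assume "u \<noteq> v"
  moreover have "a \<noteq> b" using assms(1,2) mm_E E_neq by blast
  moreover have "u \<noteq> a" "u \<noteq> b" "v \<noteq> a" "v \<noteq> b" using assms(2-4) by auto
  ultimately show False
    using mm_exchange(1)[of M "{{a, b}}" "{{u, a}, {b, v}}"] assms two_disjoint_doubletons[of u b v a]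
    by auto
qed

lemma mm_swap1:
  assumes "mm M" "{a, b} \<in> M" "u \<notin> \<Union>M" "{u, a} \<in> E"
  shows "mm (M - {{a, b}} \<union> {{u, a}})"
  by (rule mm_exchange(2)) (use assms in \<open>auto simp: pairwise_def\<close>)

lemma two_edges_distinct:
  assumes "mm M" "{a, b} \<in> M" "{c, d} \<in> M" "{a, b} \<noteq> {c, d}"
  shows "a \<noteq> b" "c \<noteq> d" "a \<noteq> c" "a \<noteq> d" "b \<noteq> c" "b \<noteq> d"
proof -
  show "a \<noteq> b" "c \<noteq> d" using assms mm_E E_neq by blast+
  have "{a, b} \<inter> {c, d} = {}" using mm_same[OF assms(1-3)] assms(4) by blast
  then show "a \<noteq> c" "a \<noteq> d" "b \<noteq> c" "b \<noteq> d" by auto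
qed

text \<open>Switching along the alternating path \<open>u\<close>, \<open>a\<close>,
  \<open>b\<close>, \<open>c\<close>, \<open>d\<close> matches \<open>u\<close> and frees
  \<open>d\<close>.\<close>

lemma mm_swap2:
  assumes "mm M" "{a, b} \<in> M" "{c, d} \<in> M" "{a, b} \<noteq> {c, d}"
    "u \<notin> \<Union>M" "{u, a} \<in> E" "{b, c} \<in> E"
  shows "mm (M - {{a, b}, {c, d}} \<union> {{u, a}, {b, c}})"
proof (rule mm_exchange(2))
  note n = two_edges_distinct[OF assms(1-4)]
  have "u \<noteq> a" "u \<noteq> b" "u \<noteq> c" "u \<noteq> d" using assms by auto
  with n show "pairwise disjnt {{u, a}, {b, c}}" "card {{a, b}, {c, d}} = card {{u, a}, {b, c}}"
    by (metis two_disjoint_doubletons)+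
  have "{a, b} \<subseteq> \<Union>M" "{c, d} \<subseteq> \<Union>M" using assms by auto
  then show "\<Union>{{u, a}, {b, c}} \<inter> \<Union>M \<subseteq> \<Union>{{a, b}, {c, d}}" using assms(5) by auto
qed (use assms in auto)

text \<open>The augmenting path \<open>u\<close>, \<open>a\<close>, \<open>b\<close>,
  \<open>c\<close>, \<open>d\<close>, \<open>v\<close> is used in two stages: switching up to
  \<open>d\<close> frees \<open>d\<close>, and then the edge from \<open>d\<close> to
  \<open>v\<close> joins two unmatched vertices.\<close>

lemma augment2:
  assumes "mm M" "{a, b} \<in> M" "{c, d} \<in> M" "{a, b} \<noteq> {c, d}"
    "u \<notin> \<Union>M" "v \<notin> \<Union>M" "{u, a} \<in> E" "{b, c} \<in> E" "{d, v} \<in> E"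
  shows "u = v"
proof (rule ccontr)
  assume "u \<noteq> v"
  note n = two_edges_distinct[OF assms(1-4)]
  let ?M = "M - {{a, b}, {c, d}} \<union> {{u, a}, {b, c}}"
  have "mm ?M" by (rule mm_swap2[OF assms(1-5,7,8)])
  moreover have "d \<notin> \<Union>?M"
  proof -
    have "\<forall>e\<in>M. d \<in> e \<longrightarrow> e = {c, d}" using mm_same[OF assms(1) _ assms(3)] by blast
    moreover have "d \<noteq> u" using assms(3,5) by auto
    ultimately show ?thesis using n by auto
  qed
  moreover have "v \<notin> \<Union>?M" using \<open>u \<noteq> v\<close> assms(2,3,6) by auto
  ultimately show False using mm_covers[OF _ assms(9)] by metis
qed

text \<open>Follow the alternating path that starts in the unmatched vertex of \<open>M2\<close> and flip it in
  \<open>M1\<close>. The clause on \<open>M1 \<inter> M2\<close> makes the induction on the size of \<open>M1 - M2\<close> work.\<close>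

lemma exchange_unmatched:
  assumes "mm M1" "mm M2" "y \<in> \<Union>M1" "y \<notin> \<Union>M2"
  shows "\<exists>M u. mm M \<and> M1 \<inter> M2 \<subseteq> M \<and> y \<notin> \<Union>M \<and> \<Union>M \<subseteq> insert u (\<Union>M1)"
  using assms
proof (induction "card (M1 - M2)" arbitrary: M2 y rule: less_induct)
  case less
  note M1 = less.prems(1) and M2 = less.prems(2)
  obtain z where z: "{y, z} \<in> M1" "y \<noteq> z" using mm_edgeE[OF M1 less.prems(3)] by blast
  then have yzE: "{y, z} \<in> E" using mm_E[OF M1] by blast
  then have "z \<in> \<Union>M2" using mm_covers[OF M2] less.prems(4) by blast
  then obtain x where x: "{z, x} \<in> M2" "z \<noteq> x" using mm_edgeE[OF M2] by blast
  then have zxE: "{x, z} \<in> E" using mm_E[OF M2] by (simp add: insert_commute)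
  have xy: "x \<noteq> y" using x less.prems(4) by auto
  have xz1: "{z, x} \<notin> M1"
    using mm_same[OF M1 z(1), of "{z, x}" z] xy x(2) z(2) by (auto simp: doubleton_eq_iff)
  show ?case
  proof (cases "x \<in> \<Union>M1")
    case False
    let ?M = "M1 - {{z, y}} \<union> {{x, z}}"
    have "mm ?M" using M1 z False zxE by (intro mm_swap1) (auto simp: insert_commute)
    moreover have "M1 \<inter> M2 \<subseteq> ?M" using less.prems(4) by auto
    moreover have "y \<notin> \<Union>?M"
    proof -
      have "\<forall>e\<in>M1. y \<in> e \<longrightarrow> e = {z, y}" using mm_same[OF M1 _ z(1)] by blast
      then show ?thesis using xy z(2) by auto
    qed
    moreover have "\<Union>?M \<subseteq> insert x (\<Union>M1)" using z(1) by auto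
    ultimately show ?thesis by blast
  next
    case True
    \<comment> \<open>Shift the gap of \<open>M2\<close> from \<open>y\<close> to \<open>x\<close>,
      two steps along the alternating path. The edge \<open>{y, z}\<close> becomes common to both
      matchings, so the difference shrinks.\<close>
    let ?M2 = "M2 - {{z, x}} \<union> {{y, z}}"
    have M2': "mm ?M2" using M2 x(1) yzE less.prems(4) by (intro mm_swap1) auto
    have "M1 - ?M2 = (M1 - M2) - {{y, z}}" using xz1 by auto
    moreover have "{y, z} \<in> M1 - M2" using z(1) less.prems(4) by auto
    ultimately have lt: "card (M1 - ?M2) < card (M1 - M2)"
      using finite_mm[OF M1] by (simp only: card_Diff1_less finite_Diff)
    have xM2: "x \<notin> \<Union>?M2"
    proof -
      have "\<forall>e\<in>M2. x \<in> e \<longrightarrow> e = {z, x}" using mm_same[OF M2 _ x(1)] by blast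
      then show ?thesis using xy x(2) by auto
    qed
    obtain M u where M: "mm M" "M1 \<inter> ?M2 \<subseteq> M" "x \<notin> \<Union>M" "\<Union>M \<subseteq> insert u (\<Union>M1)"
      using less.hyps[OF lt M1 M2' True xM2] by blast
    \<comment> \<open>The edge \<open>{z, y}\<close> lies in \<open>M1\<close> and in the shifted
      matching, so the clause on the intersection keeps it in \<open>M\<close>; it can be traded for
      \<open>{x, z}\<close>, which moves the gap from \<open>x\<close> back to
      \<open>y\<close>.\<close>
    then have zyM: "{z, y} \<in> M" using z(1) by (auto simp: insert_commute)
    let ?M = "M - {{z, y}} \<union> {{x, z}}"
    have "mm ?M" using M zyM zxE by (intro mm_swap1) auto
    moreover have "M1 \<inter> M2 \<subseteq> ?M" using M(2) xz1 less.prems(4) by auto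
    moreover have "y \<notin> \<Union>?M"
    proof -
      have "\<forall>e\<in>M. y \<in> e \<longrightarrow> e = {z, y}" using mm_same[OF M(1) _ zyM] by blast
      then show ?thesis using xy z(2) by auto
    qed
    moreover have "\<Union>?M \<subseteq> insert u (\<Union>M1)" using M(4) True z(1) by blast
    ultimately show ?thesis by blast
  qed
qed

text \<open>The argument of Gallai's lemma.\<close>

lemma nonadjacent_unmatched:
  assumes "mm M1" "x \<notin> \<Union>M1" "z \<notin> \<Union>M1" "x \<noteq> z" "mm M2" "y \<notin> \<Union>M2" "{x, y} \<in> E"
  shows "{y, z} \<notin> E"
proof
  assume yz: "{y, z} \<in> E"
  have y: "y \<in> \<Union>M1" using mm_covers[OF assms(1,7,2)] by blast
  obtain M u where M: "mm M" "y \<notin> \<Union>M" "\<Union>M \<subseteq> insert u (\<Union>M1)"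
    using exchange_unmatched[OF assms(1,5) y assms(6)] by (elim exE conjE)
  \<comment> \<open>\<open>M\<close> covers at most one vertex that \<open>M1\<close> misses, so it
    leaves \<open>x\<close> or \<open>z\<close> free together with their common neighbour
    \<open>y\<close>.\<close>
  have "x \<notin> \<Union>M \<or> z \<notin> \<Union>M" using M(3) assms(2-4) by blast
  then show False using mm_covers[OF M(1) assms(7)] mm_covers[OF M(1) yz] M(2) by argo
qed

end

section \<open>Maximum matchings without an alternating path on six vertices\<close>

text \<open>\<open>no_P6\<close> is required of all maximum matchings at once, so that a matching
  may be switched before the condition is applied. \<open>second_neighbour\<close> is the form in
  which minimum degree two is used.\<close>

locale no_alternating_P6 = max_matchings +
  assumes no_P6: "\<lbrakk>mm M; {a, b} \<in> M; {c, d} \<in> M; {e, f} \<in> M;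
      {a, b} \<noteq> {c, d}; {a, b} \<noteq> {e, f}; {c, d} \<noteq> {e, f}; {b, c} \<in> E; {d, e} \<in> E\<rbrakk> \<Longrightarrow> False"
    and second_neighbour: "{v, x} \<in> E \<Longrightarrow> \<exists>y. y \<noteq> x \<and> {v, y} \<in> E"
begin

text \<open>Replacing \<open>{a, b}\<close> by \<open>{u, b}\<close> makes \<open>f\<close>,
  \<open>e\<close>, \<open>u\<close>, \<open>b\<close>, \<open>c\<close>, \<open>d\<close> an
  alternating path.\<close>

lemma no_P6_swap1:
  assumes M: "mm M" and m: "{e, f} \<in> M" "{a, b} \<in> M" "{c, d} \<in> M"
    and ne: "{e, f} \<noteq> {a, b}" "{e, f} \<noteq> {c, d}" "{a, b} \<noteq> {c, d}"
    and u: "u \<notin> \<Union>M" and E: "{u, e} \<in> E" "{u, b} \<in> E" "{b, c} \<in> E"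
  shows False
proof -
  let ?M = "M - {{b, a}} \<union> {{u, b}}"
  have "mm ?M"
    by (rule mm_swap1[OF M _ u E(2)]) (simp add: m insert_commute)
  moreover have "{f, e} \<in> ?M" "{c, d} \<in> ?M" using m ne by (auto simp: insert_commute)
  moreover have "{f, e} \<noteq> {u, b}" "{u, b} \<noteq> {c, d}" using m u by auto
  moreover have "{e, u} \<in> E" using E(1) E_sym by blast
  ultimately show False
    using no_P6[of ?M f e u b c d] ne E(3) by (simp add: insert_commute)
qed

text \<open>Switching along \<open>u\<close>, \<open>a\<close>, \<open>b\<close>, \<open>c\<close>,
  \<open>d\<close> makes \<open>f\<close>, \<open>e\<close>, \<open>u\<close>, \<open>a\<close>,
  \<open>b\<close>, \<open>c\<close> an alternating path, in which \<open>{a, b}\<close> is now a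
  non-matching edge.\<close>

lemma no_P6_swap2:
  assumes M: "mm M" and m: "{e, f} \<in> M" "{a, b} \<in> M" "{c, d} \<in> M"
    and ne: "{e, f} \<noteq> {a, b}" "{e, f} \<noteq> {c, d}" "{a, b} \<noteq> {c, d}"
    and u: "u \<notin> \<Union>M" and E: "{u, e} \<in> E" "{u, a} \<in> E" "{b, c} \<in> E"
  shows False
proof -
  let ?M = "M - {{a, b}, {c, d}} \<union> {{u, a}, {b, c}}"
  have "mm ?M" by (rule mm_swap2[OF M m(2,3) ne(3) u E(2,3)])
  moreover have "{f, e} \<in> ?M" using m(1) ne by (simp add: insert_commute)
  moreover note two_edges_distinct[OF M m(2,3) ne(3)] two_edges_distinct[OF M m(1,2) ne(1)]
    two_edges_distinct[OF M m(1,3) ne(2)]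
  moreover have "u \<noteq> a" "u \<noteq> b" "u \<noteq> c" "u \<noteq> e" "u \<noteq> f" using u m by auto
  moreover have "{a, b} \<in> E" using mm_E[OF M m(2)] .
  ultimately show False
    using no_P6[of ?M f e u a b c] E by (auto simp: insert_commute doubleton_eq_iff)
qed

text \<open>Switching along \<open>u\<close>, \<open>f\<close>, \<open>e\<close>, \<open>b\<close>,
  \<open>a\<close> makes \<open>h\<close>, \<open>g\<close>, \<open>b\<close>, \<open>e\<close>,
  \<open>f\<close>, \<open>u\<close> an alternating path.\<close>

lemma no_P6_swap2':
  assumes M: "mm M" and m: "{g, h} \<in> M" "{a, b} \<in> M" "{e, f} \<in> M"
    and ne: "{g, h} \<noteq> {a, b}" "{g, h} \<noteq> {e, f}" "{a, b} \<noteq> {e, f}"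
    and u: "u \<notin> \<Union>M" and E: "{u, f} \<in> E" "{e, b} \<in> E" "{b, g} \<in> E"
  shows False
proof -
  have m': "{f, e} \<in> M" "{b, a} \<in> M" "{f, e} \<noteq> {b, a}" using m ne by (auto simp: insert_commute)
  let ?M = "M - {{f, e}, {b, a}} \<union> {{u, f}, {e, b}}"
  have "mm ?M" by (rule mm_swap2[OF M m' u E(1,2)])
  moreover have "{h, g} \<in> ?M" using m(1) ne by (auto simp: insert_commute)
  moreover note two_edges_distinct[OF M m(2,3) ne(3)] two_edges_distinct[OF M m(1,2) ne(1)]
    two_edges_distinct[OF M m(1,3) ne(2)]
  moreover have "u \<noteq> f" "u \<noteq> b" "u \<noteq> g" "u \<noteq> e" "u \<noteq> h" using u m by auto
  moreover have "{e, f} \<in> E" using mm_E[OF M m(3)] .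
  ultimately show False
    using no_P6[of ?M h g b e f u] E by (auto simp: insert_commute doubleton_eq_iff)
qed

section \<open>Fan components\<close>

lemma neighbours_eq_doubleton:
  assumes "{x, w} \<in> E" "\<And>v. {x, v} \<in> E \<Longrightarrow> v = p \<or> v = q"
  shows "{v. {x, v} \<in> E} = {p, q}"
proof -
  obtain y where "y \<noteq> w" "{x, y} \<in> E" using second_neighbour[OF assms(1)] by blast
  with assms have "{x, p} \<in> E \<and> {x, q} \<in> E" by metis
  with assms(2) show ?thesis by auto
qed

text \<open>Two further matching edges attached to \<open>b\<close> leave the partner
  \<open>a\<close> no neighbour except \<open>b\<close> and unmatched vertices. Degree two then
  produces a single unmatched \<open>u\<close> completing a triangle with \<open>a\<close> and
  \<open>b\<close>, and each matching edge attached to \<open>b\<close> is itself part of a triangle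
  at \<open>b\<close>. The vertex \<open>y\<close> is the third corner of the triangle through
  \<open>b\<close> and \<open>x\<close>.\<close>

lemma fan_centre:
  assumes M: "mm M" and ab: "{a, b} \<in> M" and ef: "{e, f} \<in> M" "{e, f} \<noteq> {a, b}" "{b, e} \<in> E"
    and gh: "{g, h} \<in> M" "{g, h} \<noteq> {a, b}" "{b, g} \<in> E" and ne: "{e, f} \<noteq> {g, h}"
    and x: "{b, x} \<in> E"
  shows "\<exists>y. y \<noteq> b \<and> y \<noteq> x \<and> {v. {x, v} \<in> E} = {b, y} \<and> {v. {y, v} \<in> E} = {b, x}"
proof -
  \<comment> \<open>This is why two attached edges are assumed: whichever edge an argument occupies,
    one of the two is still available to prolong a path beyond \<open>b\<close>.\<close>
  have other: "\<exists>g h. {g, h} \<in> M \<and> {g, h} \<noteq> {a, b} \<and> {g, h} \<noteq> {x, y} \<and> {b, g} \<in> E"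
    for x y using ef gh ne by metis
  have split: "v \<notin> \<Union>M \<or> v = a \<or> v = b \<or> (\<exists>y. {v, y} \<in> M \<and> {v, y} \<noteq> {a, b})" for v
  proof (cases "v \<in> \<Union>M")
    case True
    then obtain y where "{v, y} \<in> M" using mm_edgeE[OF M] by blast
    then show ?thesis by auto
  qed simp
  have baE: "{b, a} \<in> E" using mm_E[OF M ab] by (simp add: insert_commute)
  \<comment> \<open>The forbidden alternating path is \<open>y\<close>, \<open>x\<close>,
    \<open>a\<close>, \<open>b\<close>, \<open>g\<close>, \<open>h\<close>.\<close>
  have a_out: "{a, x} \<notin> E" if "{x, y} \<in> M" "{x, y} \<noteq> {a, b}" for x y
  proof
    assume ax: "{a, x} \<in> E"
    obtain g h where "{g, h} \<in> M" "{g, h} \<noteq> {a, b}" "{g, h} \<noteq> {x, y}" "{b, g} \<in> E"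
      using other by blast
    then show False
      using no_P6[OF M, of y x a b g h] that ab ax by (auto simp: insert_commute)
  qed
  have a_nbr: "v = b \<or> v \<notin> \<Union>M" if "{a, v} \<in> E" for v
    using split[of v] a_out[of v] that E_neq by blast
  obtain u where u: "{a, u} \<in> E" "u \<noteq> b"
    using second_neighbour[of a b] baE by (auto simp: insert_commute)
  then have uM: "u \<notin> \<Union>M" using a_nbr by blast
  have triangle: "{v. {e, v} \<in> E} = {b, f} \<and> {v. {f, v} \<in> E} = {b, e}"
    if e: "{e, f} \<in> M" "{e, f} \<noteq> {a, b}" "{b, e} \<in> E" for e f
  proof -
    \<comment> \<open>Stated for arbitrary \<open>e\<close>, \<open>f\<close>, because it is applied
      a second time with their roles exchanged, once \<open>f\<close> is known to be adjacent to
      \<open>b\<close>. A matched \<open>v\<close> yields the alternating path \<open>y\<close>,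
      \<open>v\<close>, \<open>f\<close>, \<open>e\<close>, \<open>b\<close>,
      \<open>a\<close>.\<close>
    have f_nbr: "v = b \<or> v = e" if ef: "{e, f} \<in> M" "{e, f} \<noteq> {a, b}" "{b, e} \<in> E" and v: "{f, v} \<in> E"
      for e f v
    proof (rule ccontr)
      assume nv: "\<not> (v = b \<or> v = e)"
      have "v \<noteq> a" using a_out[of f e] ef v by (auto simp: insert_commute)
      have "v \<notin> \<Union>M"
      proof (rule ccontr)
        assume "\<not> v \<notin> \<Union>M"
        then obtain y where y: "{v, y} \<in> M" using mm_edgeE[OF M] by blast
        have "v \<noteq> f" using v E_neq by blast
        then have "{y, v} \<noteq> {f, e}" "{y, v} \<noteq> {b, a}" using nv \<open>v \<noteq> a\<close> by auto
        then show False
          using no_P6[OF M, of y v f e b a] y ef ab v by (auto simp: insert_commute)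
      qed
      \<comment> \<open>Otherwise \<open>u\<close>, \<open>a\<close>, \<open>b\<close>,
        \<open>e\<close>, \<open>f\<close>, \<open>v\<close> would augment \<open>M\<close>. With
        \<open>u = v\<close> the edge from \<open>u\<close> to \<open>f\<close> permits the switch
        that ends in an alternating path through the other attached edge.\<close>
      moreover from this have "u = v"
        using augment2[OF M, of a b e f u v] ab ef v uM u by (auto simp: insert_commute)
      moreover obtain g h where "{g, h} \<in> M" "{g, h} \<noteq> {a, b}" "{g, h} \<noteq> {e, f}" "{b, g} \<in> E"
        using other by blast
      ultimately show False
        using no_P6_swap2'[OF M, of g h a b e f u] ab ef v by (auto simp: insert_commute)
    qed
    have "{f, e} \<in> E" using mm_E[OF M e(1)] by (simp add: insert_commute)
    then obtain w where "w \<noteq> e" "{f, w} \<in> E" using second_neighbour by blast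
    then have fb: "{b, f} \<in> E" using f_nbr[OF e, of w] E_sym by metis
    have "{f, e} \<in> M" "{f, e} \<noteq> {a, b}" using e by (auto simp: insert_commute)
    note e_nbr = f_nbr[OF this fb]
    show ?thesis using f_nbr[OF e] e_nbr fb e(3) \<open>{f, e} \<in> E\<close> by (auto simp: insert_commute)
  qed
  \<comment> \<open>If \<open>w\<close> saw a matched \<open>v\<close> elsewhere, switching along
    \<open>w\<close>, \<open>a\<close>, \<open>b\<close>, \<open>g\<close>, \<open>h\<close> would
    make \<open>y\<close>, \<open>v\<close>, \<open>w\<close>, \<open>a\<close>, \<open>b\<close>,
    \<open>g\<close> alternating.\<close>
  have b_out: "v = a \<or> v = b" if w: "{a, w} \<in> E" "w \<noteq> b" "{w, v} \<in> E" for v w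
  proof (rule ccontr)
    assume nv: "\<not> (v = a \<or> v = b)"
    have wM: "w \<notin> \<Union>M" using a_nbr[OF w(1)] w(2) by blast
    then have "v \<in> \<Union>M" using mm_covers[OF M w(3)] by blast
    then obtain y where y: "{v, y} \<in> M" using mm_edgeE[OF M] by blast
    have vy: "{v, y} \<noteq> {a, b}" using nv by auto
    obtain g h where g: "{g, h} \<in> M" "{g, h} \<noteq> {a, b}" "{g, h} \<noteq> {v, y}" "{b, g} \<in> E"
      using other by blast
    show False
      using no_P6_swap2[OF M y ab g(1) vy _ _ wM w(3)] g w(1) by (auto simp: insert_commute)
  qed
  have ub: "{b, u} \<in> E"
  proof -
    obtain v where "v \<noteq> a" "{u, v} \<in> E"
      using second_neighbour[of u a] u by (auto simp: insert_commute)
    then show ?thesis using b_out[OF u] E_sym by metis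
  qed
  \<comment> \<open>Such a \<open>v\<close> is adjacent to \<open>b\<close> in any case, by its
    second neighbour, so \<open>u\<close>, \<open>a\<close>, \<open>b\<close>, \<open>v\<close>
    would augment \<open>M\<close> unless \<open>v = u\<close>.\<close>
  have u_unique: "v = u" if v: "v \<notin> \<Union>M" "{a, v} \<in> E \<or> {b, v} \<in> E" for v
  proof -
    have "{b, v} \<in> E"
    proof (rule ccontr)
      assume bv: "{b, v} \<notin> E"
      then have av: "{a, v} \<in> E" "v \<noteq> b" using v ab by auto
      obtain w where "w \<noteq> a" "{v, w} \<in> E"
        using second_neighbour[of v a] av by (auto simp: insert_commute)
      then show False using b_out[OF av] bv E_sym by metis
    qed
    then show ?thesis using augment1[OF M ab uM v(1)] u(1) by (auto simp: insert_commute)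
  qed
  have Na: "{v. {a, v} \<in> E} = {b, u}"
  proof (rule neighbours_eq_doubleton[OF u(1)])
    show "v = b \<or> v = u" if "{a, v} \<in> E" for v using a_nbr u_unique that by blast
  qed
  have Nu: "{v. {u, v} \<in> E} = {b, a}"
  proof (rule neighbours_eq_doubleton)
    show "{u, b} \<in> E" using ub E_sym by blast
    show "v = b \<or> v = a" if "{u, v} \<in> E" for v using b_out[OF u that] by blast
  qed
  have dist: "a \<noteq> b" "u \<noteq> a" "u \<noteq> b" using baE u E_neq by auto
  consider "x \<notin> \<Union>M" | "x = a" | y where "{x, y} \<in> M" "{x, y} \<noteq> {a, b}"
    using split[of x] E_neq[OF x] by blast
  then show ?thesis
  proof cases
    case 1
    then have "x = u" using u_unique x by blast
    then show ?thesis using Na Nu dist by (intro exI[of _ a]) simp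
  next
    case 2
    then show ?thesis using Na Nu dist by (intro exI[of _ u]) simp
  next
    case 3
    have "y \<noteq> b" "y \<noteq> x" using two_edges_distinct[OF M 3(1) ab 3(2)] by auto
    then show ?thesis using triangle[OF 3 x] by (intro exI[of _ y]) simp
  qed
qed

section \<open>Components with two centres\<close>

lemma two_of_four:
  assumes "{x, w} \<in> E" "\<And>v. {x, v} \<in> E \<Longrightarrow> v \<in> {a, b, c, d}"
  defines "P \<equiv> \<lambda>v. {v, x} \<in> E"
  shows "P a \<and> P b \<or> P a \<and> P c \<or> P a \<and> P d \<or> P b \<and> P c \<or> P b \<and> P d \<or> P c \<and> P d"
proof -
  obtain y where "y \<noteq> w" "{x, y} \<in> E" using second_neighbour[OF assms(1)] by blast
  then have "y \<noteq> w" "y \<in> {a, b, c, d}" "w \<in> {a, b, c, d}" "P y" "P w"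
    using assms by (auto simp: insert_commute)
  then show ?thesis by blast
qed

text \<open>No other matching edge touches \<open>a\<close>, \<open>b\<close>, \<open>c\<close>,
  \<open>d\<close>, so the rest \<open>D\<close> of the component is unmatched and sees only these
  four. As \<open>D\<close> has at least two elements, excluding augmenting paths between them
  forces one common pair of neighbours \<open>p\<close>, \<open>q\<close>; the remaining two of the
  four vertices are then not adjacent and see only \<open>p\<close> and \<open>q\<close> as
  well.\<close>

lemma two_centres:
  assumes M: "mm M" and ab: "{a, b} \<in> M" and cd: "{c, d} \<in> M" and ne: "{a, b} \<noteq> {c, d}"
    and bc: "{b, c} \<in> E"
    and apart: "\<And>e f p. {e, f} \<in> M \<Longrightarrow> {e, f} \<noteq> {a, b} \<Longrightarrow> {e, f} \<noteq> {c, d} \<Longrightarrow>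
      p \<in> {a, b, c, d} \<Longrightarrow> {p, e} \<notin> E"
    and C: "C = {(u, v). {u, v} \<in> E}\<^sup>* `` {r}" "b \<in> C" "card C \<ge> 6"
  shows "\<exists>p\<in>C. \<exists>q\<in>C. p \<noteq> q \<and> (\<forall>v\<in>C - {p, q}. {w. {v, w} \<in> E} = {p, q})"
proof -
  note dist = two_edges_distinct[OF M ab cd ne]
  have abE: "{a, b} \<in> E" "{c, d} \<in> E" using mm_E[OF M] ab cd by auto
  have Cstep: "y \<in> C" if "x \<in> C" "{x, y} \<in> E" for x y
    using that unfolding C(1) by (rule edge_reachable_step)
  have abcdC: "{a, b, c, d} \<subseteq> C"
    using Cstep[of b a] Cstep[of b c] Cstep[of c d] abE bc C(2) by (auto simp: insert_commute)
  have nbr: "w \<in> {a, b, c, d} \<or> w \<notin> \<Union>M" if "p \<in> {a, b, c, d}" "{p, w} \<in> E" for p w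
  proof (rule ccontr)
    assume nw: "\<not> ?thesis"
    then obtain y where "{w, y} \<in> M" using mm_edgeE[OF M] by blast
    moreover have "{w, y} \<noteq> {a, b}" "{w, y} \<noteq> {c, d}" using nw by auto
    ultimately show False using apart that by blast
  qed
  have unmatched: "v \<in> {a, b, c, d}"
    if w: "w \<notin> \<Union>M" "p \<in> {a, b, c, d}" "{p, w} \<in> E" "{w, v} \<in> E" for w p v
  proof (rule ccontr)
    assume nv: "v \<notin> {a, b, c, d}"
    have "v \<in> \<Union>M" using mm_covers[OF M w(4)] w(1) by blast
    then obtain y where y: "{v, y} \<in> M" using mm_edgeE[OF M] by blast
    have n: "{v, y} \<noteq> {a, b}" "{v, y} \<noteq> {c, d}" using nv by auto
    have ba: "{b, a} \<in> M" "{d, c} \<in> M" "{v, y} \<noteq> {b, a}" "{v, y} \<noteq> {d, c}" "{c, d} \<noteq> {a, b}"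
      "{d, c} \<noteq> {b, a}" "{d, c} \<noteq> {a, b}" "{c, b} \<in> E" using ab cd n ne bc by (auto simp: insert_commute)
    have wp: "{w, p} \<in> E" using w(3) E_sym by blast
    \<comment> \<open>The reflection exchanging \<open>a\<close> with \<open>d\<close> and
      \<open>b\<close> with \<open>c\<close> reduces the last two cases to the first two.\<close>
    consider "p = a" | "p = b" | "p = c" | "p = d" using w(2) by blast
    then show False
    proof cases
      case 1
      then show ?thesis using no_P6_swap2[OF M y ab cd n ne w(1) w(4) _ bc] wp by blast
    next
      case 2
      then show ?thesis using no_P6_swap1[OF M y ab cd n ne w(1) w(4) _ bc] wp by blast
    next
      case 3
      then show ?thesis
        using no_P6_swap1[OF M y ba(2,1) ba(4,3,6) w(1) w(4) _ ba(8)] wp by blast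
    next
      case 4
      then show ?thesis
        using no_P6_swap2[OF M y ba(2,1) ba(4,3,6) w(1) w(4) _ ba(8)] wp by blast
    qed
  qed
  let ?U = "{w. w \<notin> \<Union>M \<and> (\<exists>p\<in>{a, b, c, d}. {p, w} \<in> E)}"
  have "C = {(u, v). {u, v} \<in> E}\<^sup>* `` {b}"
    using edge_reachable_eq C(1,2) by metis
  moreover have "{(u, v). {u, v} \<in> E}\<^sup>* `` {b} \<subseteq> {a, b, c, d} \<union> ?U"
  proof (rule edge_reachable_subset)
    fix x y assume "x \<in> {a, b, c, d} \<union> ?U" "{x, y} \<in> E"
    then show "y \<in> {a, b, c, d} \<union> ?U" using nbr unmatched by blast
  qed simp
  ultimately have CW: "C \<subseteq> {a, b, c, d} \<union> ?U" by simp
  define D where "D = C - {a, b, c, d}"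
  have DU: "w \<notin> \<Union>M" "\<exists>p\<in>{a, b, c, d}. {w, p} \<in> E" "\<And>v. {w, v} \<in> E \<Longrightarrow> v \<in> {a, b, c, d}"
    if "w \<in> D" for w
  proof -
    from that CW have w: "w \<in> ?U" unfolding D_def by blast
    then show "w \<notin> \<Union>M" by blast
    show "\<exists>p\<in>{a, b, c, d}. {w, p} \<in> E" using w E_sym by blast
    show "v \<in> {a, b, c, d}" if "{w, v} \<in> E" for v using w unmatched that by blast
  qed
  have "finite C" using C(3) card.infinite by fastforce
  have "card D \<ge> 2"
  proof -
    have "card {a, b, c, d} \<le> 4" by (simp add: card_insert_if)
    moreover have "card C - card {a, b, c, d} \<le> card D"
      unfolding D_def by (rule diff_card_le_card_Diff) simp
    ultimately show ?thesis using C(3) by linarith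
  qed
  then obtain u u' where u: "u \<in> D" "u' \<in> D" "u \<noteq> u'"
    by (auto simp: numeral_2_eq_2 card_le_Suc_iff)
  have two: "{a, w} \<in> E \<and> {b, w} \<in> E \<or> {a, w} \<in> E \<and> {c, w} \<in> E \<or> {a, w} \<in> E \<and> {d, w} \<in> E \<or>
    {b, w} \<in> E \<and> {c, w} \<in> E \<or> {b, w} \<in> E \<and> {d, w} \<in> E \<or> {c, w} \<in> E \<and> {d, w} \<in> E"
    if "w \<in> D" for w
    using DU(2)[OF that] two_of_four[of w _ a b c d] DU(3)[OF that] by blast
  \<comment> \<open>Each line excludes an augmenting path from \<open>w\<close> to
    \<open>w'\<close>: through \<open>{a, b}\<close> alone, through \<open>{c, d}\<close> alone, and
    through both edges joined by \<open>{b, c}\<close>. The last three use another edge joining the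
    two matching edges.\<close>
  have aug: "\<not> ({a, w} \<in> E \<and> {b, w'} \<in> E)" "\<not> ({c, w} \<in> E \<and> {d, w'} \<in> E)"
     "\<not> ({a, w} \<in> E \<and> {d, w'} \<in> E)"
     "{a, d} \<in> E \<Longrightarrow> \<not> ({b, w} \<in> E \<and> {c, w'} \<in> E)"
     "{b, d} \<in> E \<Longrightarrow> \<not> ({a, w} \<in> E \<and> {c, w'} \<in> E)"
     "{a, c} \<in> E \<Longrightarrow> \<not> ({b, w} \<in> E \<and> {d, w'} \<in> E)"
    if w: "w \<in> D" "w' \<in> D" "w \<noteq> w'" for w w'
  proof -
    note D = DU(1)[OF w(1)] DU(1)[OF w(2)]
    have ba: "{b, a} \<in> M" "{d, c} \<in> M" "{b, a} \<noteq> {d, c}" "{a, b} \<noteq> {d, c}" "{b, a} \<noteq> {c, d}"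
      using ab cd ne by (auto simp: insert_commute)
    show "\<not> ({a, w} \<in> E \<and> {b, w'} \<in> E)" using augment1[OF M ab D] w(3) E_sym by blast
    show "\<not> ({c, w} \<in> E \<and> {d, w'} \<in> E)" using augment1[OF M cd D] w(3) E_sym by blast
    show "\<not> ({a, w} \<in> E \<and> {d, w'} \<in> E)"
      using augment2[OF M ab cd ne D _ bc] w(3) E_sym by blast
    show "{a, d} \<in> E \<Longrightarrow> \<not> ({b, w} \<in> E \<and> {c, w'} \<in> E)"
      using augment2[OF M ba(1,2,3) D] w(3) E_sym by blast
    show "{b, d} \<in> E \<Longrightarrow> \<not> ({a, w} \<in> E \<and> {c, w'} \<in> E)"
      using augment2[OF M ab ba(2,4) D] w(3) E_sym by blast
    show "{a, c} \<in> E \<Longrightarrow> \<not> ({b, w} \<in> E \<and> {d, w'} \<in> E)"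
      using augment2[OF M ba(1) cd ba(5) D] w(3) E_sym by blast
  qed
  define T where "T p q w \<longleftrightarrow> (\<forall>v\<in>{a, b, c, d}. {v, w} \<in> E \<longleftrightarrow> v = p \<or> v = q)" for p q w
  \<comment> \<open>If one vertex saw both \<open>a\<close> and \<open>b\<close>, both
    \<open>a\<close> and \<open>d\<close>, or both \<open>c\<close> and \<open>d\<close>, the other
    would be left with at most one neighbour. Of the six pairs only three survive, and two different
    ones among these again augment.\<close>
  have same: "T a c w \<and> T a c w' \<or> T b d w \<and> T b d w' \<or> T b c w \<and> T b c w'"
    if w: "w \<in> D" "w' \<in> D" "w \<noteq> w'" for w w'
    using two[OF w(1)] two[OF w(2)] aug(1-3)[OF w] aug(1-3)[OF w(2,1) w(3)[symmetric]] dist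
    unfolding T_def by (simp, argo)
  have excl: "\<not> (T a c w \<and> T b d w)" "\<not> (T a c w \<and> T b c w)" "\<not> (T b d w \<and> T b c w)" for w
    using dist unfolding T_def by auto
  \<comment> \<open>With \<open>{x, y}\<close> not an edge, \<open>x\<close> and \<open>y\<close>
    have no candidates for neighbours but \<open>p\<close> and \<open>q\<close>, and degree two
    makes them adjacent to both.\<close>
  have finish: ?thesis
    if pq: "p \<in> {a, b, c, d}" "q \<in> {a, b, c, d}" "p \<noteq> q" and T: "\<And>w. w \<in> D \<Longrightarrow> T p q w"
      and xy: "{a, b, c, d} = {p, q, x, y}" "x \<notin> {p, q}" "y \<notin> {p, q}" "{x, y} \<notin> E" for p q x y
  proof -
    have nbr2: "v = p \<or> v = q" if z: "z = x \<or> z = y" "{z, v} \<in> E" for z v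
    proof -
      have zin: "z \<in> {a, b, c, d}" "z \<notin> {p, q}" using xy z by auto
      have "v \<notin> D" using T[of v] zin z(2) unfolding T_def by blast
      moreover have "v \<in> C" using Cstep z(2) zin abcdC by blast
      ultimately have "v \<in> {p, q, x, y}" unfolding D_def xy(1)[symmetric] by blast
      moreover have "v \<noteq> z" using z(2) E_neq by blast
      moreover have "{y, x} \<notin> E" using xy(4) E_sym by blast
      ultimately show ?thesis using z xy(4) by auto
    qed
    have "{w. {v, w} \<in> E} = {p, q}" if v: "v \<in> C - {p, q}" for v
    proof (cases "v \<in> D")
      case True
      show ?thesis
      proof (rule set_eqI)
        fix w
        show "w \<in> {w. {v, w} \<in> E} \<longleftrightarrow> w \<in> {p, q}"
          using DU(3)[OF True, of w] T[OF True] pq E_sym[of v w] E_sym[of w v] unfolding T_def by blast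
      qed
    next
      case False
      then have vx: "v = x \<or> v = y" using v xy(1) unfolding D_def by blast
      then have "v \<in> {a, b, c, d}" using xy(1) by auto
      then obtain w where "{v, w} \<in> E" using abE bc E_sym by blast
      then show ?thesis by (rule neighbours_eq_doubleton) (rule nbr2[OF vx])
    qed
    moreover have "p \<in> C" "q \<in> C" using pq abcdC by blast+
    ultimately show ?thesis using pq(3) by (intro bexI[of _ p] bexI[of _ q] conjI ballI)
  qed
  consider "T a c u" | "T b d u" | "T b c u" using same[OF u] by blast
  then show ?thesis
  proof cases
    case 1
    then have T: "T a c w" if "w \<in> D" for w using same[OF u(1) that] excl by metis
    have "{b, d} \<notin> E" using aug(5)[OF u] T[OF u(1)] T[OF u(2)] unfolding T_def by blast
    then show ?thesis using finish[of a c b d] T dist by auto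
  next
    case 2
    then have T: "T b d w" if "w \<in> D" for w using same[OF u(1) that] excl by metis
    have "{a, c} \<notin> E" using aug(6)[OF u] T[OF u(1)] T[OF u(2)] unfolding T_def by blast
    then show ?thesis using finish[of b d a c] T dist by auto
  next
    case 3
    then have T: "T b c w" if "w \<in> D" for w using same[OF u(1) that] excl by metis
    have "{a, d} \<notin> E" using aug(4)[OF u] T[OF u(1)] T[OF u(2)] unfolding T_def by blast
    then show ?thesis using finish[of b c a d] T dist by auto
  qed
qed

text \<open>Suppose matching edges are never joined inside \<open>C\<close>. Then an edge
  \<open>{a, b}\<close> of \<open>M\<close> in \<open>C\<close> sees only unmatched vertices, each
  of which sees nothing but \<open>a\<close> and \<open>b\<close>, hence both by degree two. Since
  \<open>C\<close> has at least two of them, they augment \<open>M\<close> through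
  \<open>{a, b}\<close>.\<close>

lemma adjacent_matching_edges:
  assumes M: "mm M" and C: "C = {(u, v). {u, v} \<in> E}\<^sup>* `` {r}" "card C \<ge> 6"
  shows "\<exists>M a b c d. mm M \<and> {a, b} \<in> M \<and> {c, d} \<in> M \<and> {a, b} \<noteq> {c, d} \<and> {b, c} \<in> E \<and> b \<in> C"
proof (rule ccontr)
  assume "\<not> ?thesis"
  then have neg: "{b, c} \<notin> E"
    if "mm M" "{a, b} \<in> M" "{c, d} \<in> M" "{a, b} \<noteq> {c, d}" "b \<in> C" for M a b c d
    using that by metis
  have Cstep: "y \<in> C" if "x \<in> C" "{x, y} \<in> E" for x y
    using that unfolding C(1) by (rule edge_reachable_step)
  have "\<exists>x. {r, x} \<in> E"
  proof (rule ccontr)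
    assume "\<not> ?thesis"
    then have "C \<subseteq> {r}" unfolding C(1) by (intro edge_reachable_subset) auto
    then have "card C \<le> card {r}" by (intro card_mono) auto
    then show False using C(2) by simp
  qed
  then obtain x where rx: "{r, x} \<in> E" by blast
  have "r \<in> C" using C(1) by simp
  moreover have "x \<in> C" using Cstep[OF \<open>r \<in> C\<close> rx] .
  moreover have "r \<in> \<Union>M \<or> x \<in> \<Union>M" using mm_covers[OF M rx] by blast
  ultimately obtain a where aC: "a \<in> C" "a \<in> \<Union>M" by blast
  then obtain b where ab: "{a, b} \<in> M" "a \<noteq> b" using mm_edgeE[OF M] by blast
  then have abE: "{a, b} \<in> E" using mm_E[OF M] by blast
  then have bC: "b \<in> C" using Cstep aC by blast
  have U: "w \<notin> \<Union>M" if p: "p \<in> {a, b}" "{p, w} \<in> E" "w \<notin> {a, b}" for p w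
  proof
    assume "w \<in> \<Union>M"
    then obtain y where y: "{w, y} \<in> M" using mm_edgeE[OF M] by blast
    obtain p' where p': "{p', p} = {a, b}" using p(1) by auto
    have "{p', p} \<in> M" "{p', p} \<noteq> {w, y}" "p \<in> C" using p' p ab aC bC by auto
    then show False using neg[OF M _ y] p(2) by blast
  qed
  have V: "v \<in> {a, b}" if p: "p \<in> {a, b}" "{p, w} \<in> E" "w \<notin> {a, b}" "{w, v} \<in> E" for p w v
  proof (rule ccontr)
    assume nv: "v \<notin> {a, b}"
    note w = U[OF p(1-3)]
    have "v \<in> \<Union>M" using mm_covers[OF M p(4)] w by blast
    then obtain y where y: "{v, y} \<in> M" using mm_edgeE[OF M] by blast
    obtain p' where p': "{p, p'} = {a, b}" using p(1) by auto
    have pp: "{p, p'} \<in> M" using p' ab by simp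
    have wp: "{w, p} \<in> E" using p(2) E_sym by blast
    \<comment> \<open>In the switched matching \<open>w\<close> is matched while
      \<open>{v, y}\<close> remains, so the edge from \<open>w\<close> to \<open>v\<close> would
      join two matching edges.\<close>
    let ?M = "M - {{p, p'}} \<union> {{w, p}}"
    have "{w, v} \<notin> E"
    proof (rule neg)
      show "mm ?M" by (rule mm_swap1[OF M pp w wp])
      show "{p, w} \<in> ?M" by (simp add: insert_commute)
      show "{v, y} \<in> ?M" using y nv p' by auto
      show "{p, w} \<noteq> {v, y}" using w y by auto
      show "w \<in> C" using Cstep[OF _ p(2)] p(1) aC bC by blast
    qed
    then show False using p(4) by blast
  qed
  have full: "{w, a} \<in> E \<and> {w, b} \<in> E" if p: "p \<in> {a, b}" "{p, w} \<in> E" "w \<notin> {a, b}" for p w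
  proof -
    have "{v. {w, v} \<in> E} = {a, b}"
      using neighbours_eq_doubleton[of w p a b] V[OF p] p(2) E_sym by blast
    then show ?thesis by blast
  qed
  let ?W = "{a, b} \<union> {w. w \<notin> {a, b} \<and> (\<exists>p\<in>{a, b}. {p, w} \<in> E)}"
  have "{(u, v). {u, v} \<in> E}\<^sup>* `` {a} \<subseteq> ?W"
  proof (rule edge_reachable_subset)
    fix x y assume "x \<in> ?W" "{x, y} \<in> E"
    then show "y \<in> ?W" using V by blast
  qed simp
  moreover have "C = {(u, v). {u, v} \<in> E}\<^sup>* `` {a}"
    using edge_reachable_eq C(1) aC(1) by metis
  ultimately have CW: "C \<subseteq> ?W" by simp
  have "card {a, b} \<le> 2" by (simp add: card_insert_if)
  moreover have "card C - card {a, b} \<le> card (C - {a, b})"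
    by (rule diff_card_le_card_Diff) simp
  ultimately have "card (C - {a, b}) \<ge> 2" using C(2) by linarith
  then obtain u u' where u: "u \<in> C - {a, b}" "u' \<in> C - {a, b}" "u \<noteq> u'"
    by (auto simp: numeral_2_eq_2 card_le_Suc_iff)
  have ex: "\<exists>p\<in>{a, b}. {p, u} \<in> E" "\<exists>p\<in>{a, b}. {p, u'} \<in> E" using u(1,2) CW by blast+
  have "u \<notin> \<Union>M" "u' \<notin> \<Union>M" using U ex u(1,2) by blast+
  moreover have "{u, a} \<in> E" "{u', b} \<in> E" using full ex u(1,2) by blast+
  ultimately show False using augment1[OF M ab(1), of u u'] u(3) E_sym by blast
qed

text \<open>Take two joined matching edges \<open>{a, b}\<close>, \<open>{c, d}\<close> and ask
  where a third one is attached. At an outer vertex \<open>a\<close> or \<open>d\<close> it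
  completes an alternating path on six vertices; at an inner vertex \<open>b\<close> or
  \<open>c\<close> it makes this vertex the centre of a fan; if there is none, two centres
  remain.\<close>

lemma component_structure:
  assumes "mm M" and C: "C = {(u, v). {u, v} \<in> E}\<^sup>* `` {r}" "card C \<ge> 6"
  shows "(\<exists>b\<in>C. \<forall>x. {b, x} \<in> E \<longrightarrow>
      (\<exists>y. y \<noteq> b \<and> y \<noteq> x \<and> {v. {x, v} \<in> E} = {b, y} \<and> {v. {y, v} \<in> E} = {b, x})) \<or>
    (\<exists>p\<in>C. \<exists>q\<in>C. p \<noteq> q \<and> (\<forall>v\<in>C - {p, q}. {w. {v, w} \<in> E} = {p, q}))"
proof -
  obtain M a b c d where M: "mm M" and ab: "{a, b} \<in> M" and cd: "{c, d} \<in> M"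
    and ne: "{a, b} \<noteq> {c, d}" and bc: "{b, c} \<in> E" and bC: "b \<in> C"
    using adjacent_matching_edges[OF assms] by (elim exE conjE)
  have cC: "c \<in> C" using bC bc unfolding C(1) by (rule edge_reachable_step)
  have sw: "{b, a} \<in> M" "{d, c} \<in> M" "{b, a} \<noteq> {d, c}" "{c, b} \<in> E"
    using ab cd ne bc by (auto simp: insert_commute)
  show ?thesis
  proof (cases "\<exists>e f p. {e, f} \<in> M \<and> {e, f} \<noteq> {a, b} \<and> {e, f} \<noteq> {c, d} \<and> p \<in> {a, b, c, d} \<and> {p, e} \<in> E")
    case False
    then have "{p, e} \<notin> E" if "{e, f} \<in> M" "{e, f} \<noteq> {a, b}" "{e, f} \<noteq> {c, d}" "p \<in> {a, b, c, d}"
      for e f p using that by metis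
    then show ?thesis using two_centres[OF M ab cd ne bc _ C(1) bC C(2)] by metis
  next
    case True
    then obtain e f p where ef: "{e, f} \<in> M" "{e, f} \<noteq> {a, b}" "{e, f} \<noteq> {c, d}"
      and p: "p \<in> {a, b, c, d}" "{p, e} \<in> E" by blast
    have fe: "{f, e} \<in> M" "{f, e} \<noteq> {a, b}" "{f, e} \<noteq> {c, d}" "{f, e} \<noteq> {b, a}" "{f, e} \<noteq> {d, c}"
      "{e, p} \<in> E"
      using ef p(2) by (auto simp: insert_commute)
    consider "p = a" | "p = b" | "p = c" | "p = d" using p(1) by blast
    then show ?thesis
    proof cases
      case 1
      then show ?thesis using no_P6[OF M fe(1) ab cd fe(2,3) ne _ bc] fe(6) by blast
    next
      case 2
      then have "{b, e} \<in> E" using p(2) by simp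
      note fan = fan_centre[OF M ab cd ne[symmetric] bc ef(1,2) this ef(3)[symmetric]]
      show ?thesis by (intro disjI1 bexI[of _ b] allI impI fan bC)
    next
      case 3
      then have "{c, e} \<in> E" "{e, f} \<noteq> {d, c}" "{b, a} \<noteq> {e, f}"
        using p(2) ef by (auto simp: insert_commute)
      note fan = fan_centre[OF M sw(2,1,3,4) ef(1) this(2,1,3)]
      show ?thesis by (intro disjI1 bexI[of _ c] allI impI fan cC)
    next
      case 4
      then show ?thesis using no_P6[OF M fe(1) sw(2,1) fe(5,4) _ _ sw(4)] fe(6) sw(3) by metis
    qed
  qed
qed

end

section \<open>Components, books and fans\<close>

lemma finite_edges: "simple_graph G \<Longrightarrow> finite (edges G)"
  by (auto simp: simple_graph_def intro: finite_subset[of _ "Pow (verts G)"])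

lemma edge_doubleton:
  assumes "simple_graph G" "e \<in> edges G" "v \<in> e"
  obtains w where "e = {v, w}" "v \<noteq> w"
proof -
  have "card e = 2" using assms by (auto simp: simple_graph_def)
  then obtain a b where "e = {a, b}" "a \<noteq> b" by (auto simp: card_2_iff)
  with assms(3) that[of a] that[of b] show thesis by (auto simp: insert_commute)
qed

lemma edge_verts: "simple_graph G \<Longrightarrow> {v, w} \<in> edges G \<Longrightarrow> v \<in> verts G \<and> w \<in> verts G \<and> v \<noteq> w"
  by (fastforce simp: simple_graph_def)

lemma reachable_step:
  "x \<in> (adjacency G)\<^sup>* `` {r} \<Longrightarrow> {x, y} \<in> edges G \<Longrightarrow> y \<in> (adjacency G)\<^sup>* `` {r}"
  unfolding adjacency_def by (rule edge_reachable_step)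

lemma reachable_eq:
  "b \<in> (adjacency G)\<^sup>* `` {r} \<Longrightarrow> (adjacency G)\<^sup>* `` {b} = (adjacency G)\<^sup>* `` {r}"
  unfolding adjacency_def by (rule edge_reachable_eq)

lemma reachable_subset:
  assumes "r \<in> W" "\<And>x y. x \<in> W \<Longrightarrow> {x, y} \<in> edges G \<Longrightarrow> y \<in> W"
  shows "(adjacency G)\<^sup>* `` {r} \<subseteq> W"
  using assms unfolding adjacency_def by (rule edge_reachable_subset)

lemma verts_component:
  assumes "simple_graph G" "v \<in> verts G"
  shows "verts (induced G ((adjacency G)\<^sup>* `` {v})) = (adjacency G)\<^sup>* `` {v}"
proof -
  have "(adjacency G)\<^sup>* `` {v} \<subseteq> verts G"
    using assms(2) edge_verts[OF assms(1)] by (intro reachable_subset) auto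
  then show ?thesis by (auto simp: induced_def)
qed

lemma component_of_edge:
  assumes G: "simple_graph G" and e: "{v, w} \<in> edges G"
  defines "C \<equiv> induced G ((adjacency G)\<^sup>* `` {v})"
  shows "C \<in> nontrivial_components G" "verts C = (adjacency G)\<^sup>* `` {v}" "{v, w} \<in> edges C"
proof -
  note vw = edge_verts[OF G e]
  show vC: "verts C = (adjacency G)\<^sup>* `` {v}" unfolding C_def using vw by (intro verts_component[OF G]) simp
  have "{v, w} \<subseteq> verts C" unfolding vC using reachable_step[of v G v w] e by auto
  moreover have "finite (verts C)" using G by (simp add: C_def induced_def simple_graph_def)
  ultimately have "card {v, w} \<le> card (verts C)" by (rule card_mono[rotated])
  moreover have "C \<in> components G" using vw by (auto simp: components_def C_def)
  ultimately show "C \<in> nontrivial_components G" using vw by (simp add: nontrivial_components_def)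
  show "{v, w} \<in> edges C"
    using \<open>{v, w} \<subseteq> verts C\<close> e unfolding vC by (simp add: C_def induced_def)
qed

lemma edges_nontrivial_part:
  assumes G: "simple_graph G"
  shows "edges (nontrivial_part G) = edges G"
proof
  show "edges (nontrivial_part G) \<subseteq> edges G"
    by (auto simp: nontrivial_part_def graph_Union_def nontrivial_components_def components_def
        induced_def)
  show "edges G \<subseteq> edges (nontrivial_part G)"
  proof
    fix e assume e: "e \<in> edges G"
    then have "card e = 2" using G by (auto simp: simple_graph_def)
    then obtain v w where vw: "e = {v, w}" by (auto simp: card_2_iff)
    then have "{v, w} \<in> edges G" using e by simp
    from component_of_edge(1,3)[OF G this] show "e \<in> edges (nontrivial_part G)"
      unfolding vw by (auto simp: nontrivial_part_def graph_Union_def)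
  qed
qed

text \<open>A vertex on no edge reaches only itself, so its component has a single vertex; passing
  to the nontrivial part removes exactly the isolated vertices.\<close>

lemma verts_nontrivial_part:
  assumes G: "simple_graph G"
  shows "verts (nontrivial_part G) = \<Union>(edges G)"
proof
  show "\<Union>(edges G) \<subseteq> verts (nontrivial_part G)"
  proof
    fix v assume "v \<in> \<Union>(edges G)"
    then obtain w where "{v, w} \<in> edges G" using edge_doubleton[OF G] by blast
    note C = component_of_edge[OF G this]
    then have "v \<in> verts (induced G ((adjacency G)\<^sup>* `` {v}))" by simp
    with C(1) show "v \<in> verts (nontrivial_part G)"
      by (auto simp: nontrivial_part_def graph_Union_def)
  qed
  show "verts (nontrivial_part G) \<subseteq> \<Union>(edges G)"
  proof
    fix v assume "v \<in> verts (nontrivial_part G)"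
    then obtain r where r: "r \<in> verts G" and v: "v \<in> verts (induced G ((adjacency G)\<^sup>* `` {r}))"
      and card: "card (verts (induced G ((adjacency G)\<^sup>* `` {r}))) \<ge> 2"
      by (auto simp: nontrivial_part_def graph_Union_def nontrivial_components_def components_def)
    have "v \<in> (adjacency G)\<^sup>* `` {r}" using v r verts_component[OF G r] by simp
    then have eq: "(adjacency G)\<^sup>* `` {v} = (adjacency G)\<^sup>* `` {r}" by (rule reachable_eq)
    show "v \<in> \<Union>(edges G)"
    proof (rule ccontr)
      assume "v \<notin> \<Union>(edges G)"
      then have "(adjacency G)\<^sup>* `` {v} \<subseteq> {v}" by (intro reachable_subset) auto
      then have "card ((adjacency G)\<^sup>* `` {r}) \<le> card {v}" unfolding eq by (intro card_mono) auto
      then show False using card verts_component[OF G r] by simp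
    qed
  qed
qed

lemma min_degree_second_neighbour:
  assumes G: "simple_graph G" and deg: "min_degree (nontrivial_part G) \<ge> 2"
    and vx: "{v, x} \<in> edges G"
  shows "\<exists>y. y \<noteq> x \<and> {v, y} \<in> edges G"
proof (rule ccontr)
  assume neg: "\<not> ?thesis"
  have "finite (\<Union>(edges G))"
    using G by (auto simp: simple_graph_def intro: finite_subset[of _ "verts G"])
  then have "min_degree (nontrivial_part G) \<le> degree (nontrivial_part G) v"
    unfolding min_degree_def using vx by (intro Min_le) (auto simp: verts_nontrivial_part[OF G])
  also have "\<dots> = card {e \<in> edges G. v \<in> e}"
    by (simp add: degree_def edges_nontrivial_part[OF G])
  also have "\<dots> \<le> card {{v, x}}"
  proof (rule card_mono)
    show "{e \<in> edges G. v \<in> e} \<subseteq> {{v, x}}"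
    proof
      fix e assume "e \<in> {e \<in> edges G. v \<in> e}"
      then have e: "e \<in> edges G" "v \<in> e" by auto
      then obtain y where "e = {v, y}" using edge_doubleton[OF G] by metis
      then show "e \<in> {{v, x}}" using neg e by auto
    qed
  qed simp
  finally show False using deg by simp
qed

section \<open>Recognising books and fans from their adjacency\<close>

lemma isomorphicI:
  assumes g: "bij_betw g (verts H) (verts G)"
    and edg: "\<And>u v. u \<in> verts H \<Longrightarrow> v \<in> verts H \<Longrightarrow> {u, v} \<in> edges H \<longleftrightarrow> {g u, g v} \<in> edges G"
  shows "isomorphic G H"
  unfolding isomorphic_def
proof (intro exI conjI ballI)
  let ?f = "inv_into (verts H) g"
  show "bij_betw ?f (verts G) (verts H)" using g by (rule bij_betw_inv_into)
  fix x y assume "x \<in> verts G" "y \<in> verts G"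
  then have "x \<in> g ` verts H" "y \<in> g ` verts H" using g by (simp_all add: bij_betw_def)
  then obtain u v where uv: "u \<in> verts H" "v \<in> verts H" "x = g u" "y = g v" by blast
  then have "?f x = u" "?f y = v" using g by (simp_all add: bij_betw_inv_into_left)
  with uv edg[of u v] show "{x, y} \<in> edges G \<longleftrightarrow> {?f x, ?f y} \<in> edges H" by simp
qed

text \<open>The condition \<open>m \<ge> 1\<close> matters: the book without pages is empty, while
  the remaining conditions would still admit the edge \<open>{0, 1}\<close>.\<close>

lemma edges_book:
  "{u, v} \<in> edges (book m) \<longleftrightarrow> m \<ge> 1 \<and> u \<noteq> v \<and> u < m + 2 \<and> v < m + 2 \<and> (u < 2 \<or> v < 2)"
proof -
  have "{u, v} \<in> edges (book m) \<longleftrightarrow>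
      (\<exists>i<m. {u, v} = {0, 1} \<or> {u, v} = {0, i + 2} \<or> {u, v} = {1, i + 2})"
  proof -
    have "edges (book m) = (\<Union>i<m. {{0, 1}, {0, i + 2}, {1, i + 2}})"
      by (simp add: book_def graph_Union_def triangle_def)
    then show ?thesis
      by (simp only: UN_iff insert_iff empty_iff Bex_def lessThan_iff simp_thms)
  qed
  also have "\<dots> \<longleftrightarrow> m \<ge> 1 \<and> u \<noteq> v \<and> u < m + 2 \<and> v < m + 2 \<and> (u < 2 \<or> v < 2)" (is "?L \<longleftrightarrow> ?R")
  proof
    show ?R if ?L using that by (auto simp: doubleton_eq_iff)
    show ?L if R: ?R
    proof -
      have "u = 0 \<and> v = 1 \<or> u = 1 \<and> v = 0 \<or> u < 2 \<and> v \<ge> 2 \<or> v < 2 \<and> u \<ge> 2"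
        using R by arith
      then consider "{u, v} = {0, 1}" | "u < 2" "v \<ge> 2" | "v < 2" "u \<ge> 2"
        by (auto simp: doubleton_eq_iff)
      then show ?thesis
      proof cases
        case 1
        moreover have "0 < m" using R by simp
        ultimately show ?thesis by blast
      next
        case 2
        then have "{u, v} = {0, (v - 2) + 2} \<or> {u, v} = {1, (v - 2) + 2}" "v - 2 < m"
          using R by (auto simp: less_2_cases_iff)
        then show ?thesis by blast
      next
        case 3
        then have "{u, v} = {0, (u - 2) + 2} \<or> {u, v} = {1, (u - 2) + 2}" "u - 2 < m"
          using R by (auto simp: less_2_cases_iff insert_commute)
        then show ?thesis by blast
      qed
    qed
  qed
  finally show ?thesis .
qed

lemma verts_book: "m \<ge> 1 \<Longrightarrow> verts (book m) = {..<m + 2}"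
proof -
  assume m: "m \<ge> 1"
  have "verts (book m) = (\<Union>i<m. {0, 1, i + 2})"
    by (auto simp: book_def graph_Union_def triangle_def)
  also have "\<dots> = {..<m + 2}"
  proof (intro equalityI subsetI)
    fix k assume k: "k \<in> {..<m + 2}"
    have "0 < m" "k = 0 \<or> k = 1 \<or> k = (k - 2) + 2 \<and> k - 2 < m" using m k by auto
    then show "k \<in> (\<Union>i<m. {0, 1, i + 2})" by blast
  next
    fix k assume "k \<in> (\<Union>i<m. {0, 1, i + 2})"
    then obtain i where "i < m" "k \<in> {0, 1, i + 2}" by blast
    then show "k \<in> {..<m + 2}" by auto
  qed
  finally show ?thesis .
qed

text \<open>For a positive vertex \<open>k\<close> the number \<open>(k - 1) div 2\<close> is the
  index of its triangle. At 0 the truncated subtraction has no meaning, and the centre is covered by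
  its own disjuncts.\<close>

lemma edges_fan:
  "{u, v} \<in> edges (fan m) \<longleftrightarrow>
    u \<noteq> v \<and> u \<le> 2 * m \<and> v \<le> 2 * m \<and> (u = 0 \<or> v = 0 \<or> (u - 1) div 2 = (v - 1) div 2)"
proof -
  have "{u, v} \<in> edges (fan m) \<longleftrightarrow> (\<exists>i<m. {u, v} = {0, 2 * i + 1} \<or> {u, v} = {0, 2 * i + 2} \<or>
      {u, v} = {2 * i + 1, 2 * i + 2})"
  proof -
    have "edges (fan m) =
        (\<Union>i<m. {{0, 2 * i + 1}, {0, 2 * i + 2}, {2 * i + 1, 2 * i + 2}})"
      by (simp add: fan_def graph_Union_def triangle_def)
    then show ?thesis
      by (simp only: UN_iff insert_iff empty_iff Bex_def lessThan_iff simp_thms)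
  qed
  also have "\<dots> \<longleftrightarrow>
    u \<noteq> v \<and> u \<le> 2 * m \<and> v \<le> 2 * m \<and> (u = 0 \<or> v = 0 \<or> (u - 1) div 2 = (v - 1) div 2)"
    (is "?L \<longleftrightarrow> ?R")
  proof
    show ?R if ?L using that by (auto simp: doubleton_eq_iff)
    show ?L if R: ?R
    proof -
      define i where "i = (if u = 0 then v - 1 else u - 1) div 2"
      have half: "k = 0 \<or> k = 2 * ((k - 1) div 2) + 1 \<or> k = 2 * ((k - 1) div 2) + 2" for k :: nat
        by presburger
      have "i < m" using R unfolding i_def by auto
      moreover have "(u = 0 \<or> u = 2 * i + 1 \<or> u = 2 * i + 2) \<and> (v = 0 \<or> v = 2 * i + 1 \<or> v = 2 * i + 2)"
        using R half[of u] half[of v] unfolding i_def by (cases "u = 0") auto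
      then have "{u, v} = {0, 2 * i + 1} \<or> {u, v} = {0, 2 * i + 2} \<or> {u, v} = {2 * i + 1, 2 * i + 2}"
        using R by (elim conjE disjE) (simp_all add: insert_commute)
      ultimately show ?thesis by blast
    qed
  qed
  finally show ?thesis .
qed

lemma verts_fan: "m \<ge> 1 \<Longrightarrow> verts (fan m) = {..2 * m}"
proof -
  assume m: "m \<ge> 1"
  have "verts (fan m) = (\<Union>i<m. {0, 2 * i + 1, 2 * i + 2})"
    by (auto simp: fan_def graph_Union_def triangle_def)
  also have "\<dots> = {..2 * m}"
  proof (intro equalityI subsetI)
    fix k assume k: "k \<in> {..2 * m}"
    have "(k - 1) div 2 < m" using k m by auto
    moreover have "k = 0 \<or> k = 2 * ((k - 1) div 2) + 1 \<or> k = 2 * ((k - 1) div 2) + 2" by presburger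
    ultimately show "k \<in> (\<Union>i<m. {0, 2 * i + 1, 2 * i + 2})" by blast
  next
    fix k assume "k \<in> (\<Union>i<m. {0, 2 * i + 1, 2 * i + 2})"
    then obtain i where "i < m" "k \<in> {0, 2 * i + 1, 2 * i + 2}" by blast
    then show "k \<in> {..2 * m}" by auto
  qed
  finally show ?thesis .
qed

lemma isomorphic_book:
  assumes fin: "finite (verts C)" and pq: "p \<in> verts C" "q \<in> verts C" "p \<noteq> q" and card: "card (verts C) \<ge> 3"
    and edg: "\<And>x y. x \<in> verts C \<Longrightarrow> y \<in> verts C \<Longrightarrow>
      {x, y} \<in> edges C \<longleftrightarrow> x \<noteq> y \<and> (x \<in> {p, q} \<or> y \<in> {p, q})"
  shows "\<exists>m\<ge>1. isomorphic C (book m)"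
proof -
  define m where "m = card (verts C - {p, q})"
  have "card (verts C) = m + 2" using fin pq card by (simp add: m_def card_Diff_subset)
  then have m: "m \<ge> 1" using card by simp
  obtain h where h: "bij_betw h {..<m} (verts C - {p, q})"
    using ex_bij_betw_nat_finite[of "verts C - {p, q}"] fin by (auto simp: m_def atLeast0LessThan)
  define g where "g k = (if k = 0 then p else if k = 1 then q else h (k - 2))" for k :: nat
  have hk: "h (k - 2) \<in> verts C - {p, q}" if "k \<ge> 2" "k < m + 2" for k
    using h that bij_betwE by (metis lessThan_iff less_diff_conv2)
  have g01: "g k \<in> {p, q} \<longleftrightarrow> k < 2" if "k < m + 2" for k
    using hk[of k] that by (auto simp: g_def)
  have gC: "g k \<in> verts C" if "k < m + 2" for k
    using hk[of k] pq that by (auto simp: g_def)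
  have inj: "u = v" if uv: "u < m + 2" "v < m + 2" "g u = g v" for u v
  proof (cases "u < 2")
    case True
    then have "v < 2" using g01[OF uv(1)] g01[OF uv(2)] uv(3) by simp
    then show ?thesis using True uv(3) pq(3) by (auto simp: g_def less_2_cases_iff)
  next
    case False
    then have "\<not> v < 2" using g01[OF uv(1)] g01[OF uv(2)] uv(3) by simp
    then have "h (u - 2) = h (v - 2)" using False uv(3) by (auto simp: g_def)
    then have "u - 2 = v - 2"
      using h uv False \<open>\<not> v < 2\<close> unfolding bij_betw_def inj_on_def by auto
    then show ?thesis using False \<open>\<not> v < 2\<close> by simp
  qed
  have "isomorphic C (book m)"
  proof (rule isomorphicI)
    show "bij_betw g (verts (book m)) (verts C)"
      unfolding bij_betw_def verts_book[OF m]
    proof (intro conjI inj_onI equalityI subsetI)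
      fix x assume x: "x \<in> verts C"
      show "x \<in> g ` {..<m + 2}"
      proof (cases "x \<in> {p, q}")
        case True
        then have "x = g 0 \<or> x = g 1" by (auto simp: g_def)
        then show ?thesis by auto
      next
        case False
        then have "x \<in> h ` {..<m}" using h x by (simp add: bij_betw_def)
        then obtain i where "i < m" "h i = x" by blast
        then show ?thesis by (intro image_eqI[of _ _ "i + 2"]) (auto simp: g_def)
      qed
    qed (use inj gC in auto)
    fix u v assume "u \<in> verts (book m)" "v \<in> verts (book m)"
    then have uv: "u < m + 2" "v < m + 2" by (simp_all add: verts_book[OF m])
    show "{u, v} \<in> edges (book m) \<longleftrightarrow> {g u, g v} \<in> edges C"
      unfolding edges_book edg[OF gC[OF uv(1)] gC[OF uv(2)]] g01[OF uv(1)] g01[OF uv(2)]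
      using m uv inj[OF uv] by auto
  qed
  with m show ?thesis by blast
qed

text \<open>The involution \<open>s\<close> pairs the vertices other than \<open>b\<close>.
  Enumerating the pairs and choosing a representative \<open>r i\<close> in each numbers the
  triangles; odd numbers go to representatives, positive even ones to their partners.\<close>

lemma isomorphic_fan:
  assumes fin: "finite (verts C)" and b: "b \<in> verts C" and card: "card (verts C) \<ge> 2"
    and s: "\<And>x. x \<in> verts C - {b} \<Longrightarrow> s x \<in> verts C - {b} \<and> s x \<noteq> x \<and> s (s x) = x"
    and edg: "\<And>x y. x \<in> verts C \<Longrightarrow> y \<in> verts C \<Longrightarrow>
      {x, y} \<in> edges C \<longleftrightarrow> x \<noteq> y \<and> (x = b \<or> y = b \<or> y = s x)"
  shows "\<exists>m\<ge>1. isomorphic C (fan m)"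
proof -
  define N where "N = verts C - {b}"
  define pr where "pr x = {x, s x}" for x
  define m where "m = card (pr ` N)"
  have "N \<noteq> {}" using card b fin unfolding N_def
    by (metis One_nat_def card_Diff_singleton card.empty diff_is_0_eq not_less_eq_eq numeral_2_eq_2)
  then have m: "m \<ge> 1" using fin unfolding m_def N_def by (simp add: Suc_le_eq card_gt_0_iff)
  obtain h where h: "bij_betw h {..<m} (pr ` N)"
    using ex_bij_betw_nat_finite[of "pr ` N"] fin by (auto simp: m_def N_def atLeast0LessThan)
  have "\<forall>i. \<exists>x. i < m \<longrightarrow> x \<in> N \<and> h i = pr x" using h unfolding bij_betw_def by blast
  then obtain r where r: "\<And>i. i < m \<Longrightarrow> r i \<in> N \<and> h i = pr (r i)" by metis
  have sN: "s x \<in> N \<and> s x \<noteq> x \<and> s (s x) = x" if "x \<in> N" for x using s that by (simp add: N_def)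
  have prs: "pr (s x) = pr x" if "x \<in> N" for x using sN[OF that] by (auto simp: pr_def)
  define ix where "ix k = (k - 1) div 2" for k :: nat
  define g where "g k = (if k = 0 then b else if odd k then r (ix k) else s (r (ix k)))" for k :: nat
  have ix: "ix k < m" if "k \<le> 2 * m" for k using that m unfolding ix_def by auto
  have gN: "g k \<in> N" "pr (g k) = h (ix k)" if "k \<le> 2 * m" "k > 0" for k
    using r[OF ix[OF that(1)]] that sN prs by (auto simp: g_def)
  have gb: "g k = b \<longleftrightarrow> k = 0" if "k \<le> 2 * m" for k
    using gN(1)[of k] that by (auto simp: g_def N_def)
  have gC: "g k \<in> verts C" if "k \<le> 2 * m" for k
    using gN(1)[of k] that b by (cases "k = 0") (auto simp: g_def N_def)
  have hpr: "ix u = ix v \<longleftrightarrow> pr (g u) = pr (g v)" if "u \<le> 2 * m" "v \<le> 2 * m" "u > 0" "v > 0" for u v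
    using gN(2) that h ix unfolding bij_betw_def inj_on_def by (metis lessThan_iff)
  have inj: "u = v" if uv: "u \<le> 2 * m" "v \<le> 2 * m" "g u = g v" for u v
  proof (cases "u = 0 \<or> v = 0")
    case True
    then show ?thesis using gb uv by metis
  next
    case False
    then have eq: "ix u = ix v" using hpr uv by simp
    have "s (r (ix u)) \<noteq> r (ix u)" using sN r[OF ix[OF uv(1)]] by blast
    then have "odd u \<longleftrightarrow> odd v" using uv(3) False eq by (auto simp: g_def split: if_splits)
    then show ?thesis using eq False unfolding ix_def by presburger
  qed
  have "isomorphic C (fan m)"
  proof (rule isomorphicI)
    show "bij_betw g (verts (fan m)) (verts C)"
      unfolding bij_betw_def verts_fan[OF m]
    proof (intro conjI inj_onI equalityI subsetI)
      fix x assume x: "x \<in> verts C"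
      show "x \<in> g ` {..2 * m}"
      proof (cases "x = b")
        case True
        then show ?thesis by (intro image_eqI[of _ _ 0]) (auto simp: g_def)
      next
        case False
        then have "x \<in> N" using x by (simp add: N_def)
        then have "pr x \<in> h ` {..<m}" using h by (simp add: bij_betw_def)
        then obtain i where i: "i < m" "h i = pr x" by auto
        then have "x \<in> pr (r i)" using r[OF i(1)] by (simp add: pr_def)
        then have "x = g (2 * i + 1) \<or> x = g (2 * i + 2)" by (auto simp: pr_def g_def ix_def)
        then show ?thesis using i(1) by auto
      qed
    qed (use inj gC in auto)
    fix u v assume "u \<in> verts (fan m)" "v \<in> verts (fan m)"
    then have uv: "u \<le> 2 * m" "v \<le> 2 * m" by (simp_all add: verts_fan[OF m])
    have *: "g v = s (g u) \<longleftrightarrow> ix u = ix v" if "u > 0" "v > 0" "u \<noteq> v"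
    proof -
      have "g u \<noteq> g v" using inj[OF uv] that by blast
      moreover have "pr (g u) = pr (g v) \<longleftrightarrow> g u = g v \<or> g v = s (g u)"
        using sN[of "g u"] sN[of "g v"] gN(1) uv that unfolding pr_def doubleton_eq_iff by auto
      ultimately show ?thesis using hpr[OF uv that(1,2)] by blast
    qed
    show "{u, v} \<in> edges (fan m) \<longleftrightarrow> {g u, g v} \<in> edges C"
      unfolding edges_fan edg[OF gC[OF uv(1)] gC[OF uv(2)]] gb[OF uv(1)] gb[OF uv(2)]
      using uv inj[OF uv] * unfolding ix_def by (cases "u = v"; cases "u = 0"; cases "v = 0") auto
  qed
  with m show ?thesis by blast
qed

text \<open>In the complete bipartite graph between \<open>{p, q}\<close> and the rest of \<open>S\<close>, the new edge \<open>{p, q}\<close>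
  can only serve as a matching edge, and then \<open>{p, x}\<close> replaces it.\<close>

lemma path_matching_insert_edge:
  assumes pm: "path_matching (insert {p, q} E) 6 t" and E: "\<And>e. e \<in> E \<Longrightarrow> card e = 2"
    and pq: "p \<in> S" "q \<in> S" "p \<noteq> q" and S: "card S \<ge> 3"
    and closed: "\<And>x y. x \<in> S \<Longrightarrow> {x, y} \<in> E \<Longrightarrow> y \<in> S"
    and nbr: "\<And>v. v \<in> S - {p, q} \<Longrightarrow> {w. {v, w} \<in> E} = {p, q}"
  shows "path_matching E 6 t"
proof -
  obtain f M where f: "inj_on f {..<6}" "\<And>i. Suc i < 6 \<Longrightarrow> {f i, f (Suc i)} \<in> insert {p, q} E"
    and M: "matching (insert {p, q} E) M" "card M = t" "f ` {..<6} \<inter> \<Union>M = {}"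
    using pm unfolding path_matching_def by blast
  have fdisj: "f i \<notin> S" if i: "i < 6" for i
  proof
    assume fi: "f i \<in> S"
    \<comment> \<open>\<open>S\<close> is closed under old edges and contains both ends of the new
      one, so the path lies entirely in \<open>S\<close> or entirely outside it.\<close>
    have step: "f j \<in> S \<longleftrightarrow> f (Suc j) \<in> S" if "Suc j < 6" for j
      using f(2)[OF that] closed[of "f j" "f (Suc j)"] closed[of "f (Suc j)" "f j"] pq
      by (auto simp: insert_commute doubleton_eq_iff)
    have "f j \<in> S \<longleftrightarrow> f 0 \<in> S" if "j < 6" for j
      using that by (induction j) (auto simp: step[symmetric])
    then have all: "f j \<in> S" if "j < 6" for j using that fi i by blast
    have hit: "f j \<in> {p, q} \<or> f (Suc j) \<in> {p, q}" if "Suc j < 6" for j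
      using f(2)[OF that] nbr[of "f j"] all[of j] that by (auto simp: doubleton_eq_iff)
    \<comment> \<open>The three disjoint edges of a six-vertex path in \<open>S\<close> would each
      need a vertex of \<open>{p, q}\<close>, which has only two.\<close>
    obtain i j k where ijk: "i \<in> {0, 1}" "f i \<in> {p, q}" "j \<in> {2, 3}" "f j \<in> {p, q}"
        "k \<in> {4, 5}" "f k \<in> {p, q}"
      using hit[of 0] hit[of 2] hit[of 4] by auto
    then have "i \<noteq> j" "i \<noteq> k" "j \<noteq> k" "i < 6" "j < 6" "k < 6" by auto
    then have "f i \<noteq> f j" "f i \<noteq> f k" "f j \<noteq> f k" using f(1) by (auto simp: inj_on_def)
    then show False using ijk by auto
  qed
  have path: "{f i, f (Suc i)} \<in> E" if "Suc i < 6" for i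
  proof -
    have "{f i, f (Suc i)} \<noteq> {p, q}" using fdisj[of i] that pq by auto
    then show ?thesis using f(2)[OF that] by blast
  qed
  show ?thesis
  proof (cases "{p, q} \<in> M")
    case False
    then have "matching E M" using M(1) by (auto simp: matching_def)
    then show ?thesis unfolding path_matching_def using f(1) path M by blast
  next
    case True
    have "\<not> S \<subseteq> {p, q}"
    proof
      assume "S \<subseteq> {p, q}"
      then have "card S \<le> card {p, q}" by (rule card_mono[rotated]) simp
      then show False using S pq by simp
    qed
    then obtain x where x: "x \<in> S - {p, q}" by blast
    \<comment> \<open>The other matching edges avoid \<open>p\<close> and \<open>q\<close>, and the
      rest of \<open>S\<close> has no further neighbours; hence \<open>x\<close> is free to replace
      \<open>q\<close>.\<close>
    have disj: "e \<inter> S = {}" if e: "e \<in> M - {{p, q}}" for e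
    proof -
      have eE: "e \<in> E" using e M(1) by (auto simp: matching_def)
      have epq: "p \<notin> e" "q \<notin> e"
        using e True matching_same[OF M(1) _ True, of e] by blast+
      show ?thesis
      proof (rule ccontr)
        assume "e \<inter> S \<noteq> {}"
        then obtain v where v: "v \<in> e" "v \<in> S - {p, q}" using epq by blast
        obtain a b where "e = {a, b}" using E[OF eE] by (auto simp: card_2_iff)
        then obtain w where "e = {v, w}" using v(1) by (auto simp: insert_commute)
        then show False using nbr[OF v(2)] eE epq by auto
      qed
    qed
    let ?M = "insert {p, x} (M - {{p, q}})"
    have "{x, p} \<in> E" using nbr[OF x] by blast
    then have px: "{p, x} \<in> E" by (simp add: insert_commute)
    have "matching E ?M"
      unfolding matching_def
    proof
      show "?M \<subseteq> E" using M(1) px by (auto simp: matching_def)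
      have "disjnt {p, x} e" "disjnt e {p, x}" if "e \<in> M - {{p, q}}" for e
        using disj[OF that] x pq by (auto simp: disjnt_def)
      moreover have "pairwise disjnt (M - {{p, q}})"
        using M(1) by (auto simp: matching_def pairwise_def)
      ultimately show "pairwise disjnt ?M" by (simp add: pairwise_insert)
    qed
    moreover have "card ?M = t"
    proof (cases "finite M")
      case True
      moreover have "{p, x} \<notin> M - {{p, q}}" using disj[of "{p, x}"] x by blast
      ultimately have "card ?M = Suc (card (M - {{p, q}}))" by simp
      then show ?thesis using M(2) \<open>{p, q} \<in> M\<close> \<open>finite M\<close> by (simp only: card_Suc_Diff1)
    next
      case False
      then show ?thesis using M(2) by simp
    qed
    moreover have "f ` {..<6} \<inter> \<Union>?M = {}"
      using M(3) fdisj x pq(1) by blast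
    ultimately show ?thesis unfolding path_matching_def using f(1) path by blast
  qed
qed

section \<open>The two conclusions\<close>

lemma max_matchings_Max:
  assumes "simple_graph G"
  defines "\<nu> \<equiv> Max (card ` {M. matching (edges G) M})"
  shows "max_matchings (edges G) \<nu>" "\<exists>M. matching (edges G) M \<and> card M = \<nu>"
proof -
  have "{M. matching (edges G) M} \<subseteq> Pow (edges G)" by (auto simp: matching_def)
  then have fin: "finite (card ` {M. matching (edges G) M})"
    using finite_edges[OF assms(1)] by (auto intro: finite_subset)
  have "matching (edges G) {}" by (simp add: matching_def)
  then have ne: "card ` {M. matching (edges G) M} \<noteq> {}" by blast
  show "max_matchings (edges G) \<nu>"
  proof
    show "card M \<le> \<nu>" if "matching (edges G) M" for M
      unfolding \<nu>_def using fin that by (intro Max_ge) auto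
  qed (use assms finite_edges in \<open>auto simp: simple_graph_def\<close>)
  have "\<nu> \<in> card ` {M. matching (edges G) M}" unfolding \<nu>_def using fin ne by (rule Max_in)
  then show "\<exists>M. matching (edges G) M \<and> card M = \<nu>" by auto
qed

text \<open>The path consumes three edges of \<open>M\<close>, and at least
  \<open>\<nu> - 3 \<ge> t\<close> others remain, all disjoint from it.\<close>

lemma (in max_matchings) path_matching_alternating_P6:
  assumes M: "mm M" and m: "{a, b} \<in> M" "{c, d} \<in> M" "{e, f} \<in> M"
    and ne: "{a, b} \<noteq> {c, d}" "{a, b} \<noteq> {e, f}" "{c, d} \<noteq> {e, f}"
    and E: "{b, c} \<in> E" "{d, e} \<in> E" and t: "t + 3 \<le> \<nu>"
  shows "path_matching E 6 t"
proof -
  let ?A = "{{a, b}, {c, d}, {e, f}}"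
  let ?p = "\<lambda>i. [a, b, c, d, e, f] ! i"
  have cM: "card M = \<nu>" "matching E M" using M by (auto simp: mm_def)
  have "card ?A \<le> 3" by (simp add: card_insert_if)
  moreover have "card M - card ?A \<le> card (M - ?A)" by (rule diff_card_le_card_Diff) simp
  ultimately have "t \<le> card (M - ?A)" using t cM(1) by linarith
  then obtain N where N: "N \<subseteq> M - ?A" "card N = t"
    using obtain_subset_with_card_n by metis
  have set: "?p ` {..<6} = {a, b, c, d, e, f}"
    by (auto simp: numeral_nat lessThan_Suc)
  show ?thesis
    unfolding path_matching_def
  proof (intro exI conjI allI impI)
    have "distinct [a, b, c, d, e, f]"
      using two_edges_distinct[OF M m(1,2) ne(1)] two_edges_distinct[OF M m(1,3) ne(2)]
        two_edges_distinct[OF M m(2,3) ne(3)] by auto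
    then show "inj_on ?p {..<6}"
      by (intro inj_on_nth) auto
    show "{?p i, ?p (Suc i)} \<in> E" if "Suc i < 6" for i
    proof -
      have "i \<in> {0, 1, 2, 3, 4}" using that by auto
      then show ?thesis using mm_E[OF M] m E by auto
    qed
    show "matching E N" using cM(2) N(1) unfolding matching_def pairwise_def by blast
    show "card N = t" by fact
    have "e' \<inter> {a, b, c, d, e, f} = {}" if e': "e' \<in> N" for e'
    proof -
      have "e' \<in> M" "e' \<noteq> {a, b}" "e' \<noteq> {c, d}" "e' \<noteq> {e, f}" using e' N(1) by auto
      then have "e' \<inter> {a, b} = {}" "e' \<inter> {c, d} = {}" "e' \<inter> {e, f} = {}"
        using mm_same[OF M _ m(1)] mm_same[OF M _ m(2)] mm_same[OF M _ m(3)] by blast+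
      then show ?thesis by blast
    qed
    then show "?p ` {..<6} \<inter> \<Union>N = {}" unfolding set by blast
  qed
qed

section \<open>Smaller forests contained in the two linear forests\<close>

lemma matching_insert:
  assumes "matching E M" "e \<in> E" "e \<inter> \<Union>M = {}" "e \<noteq> {}" "finite M"
  shows "matching E (insert e M)" "card (insert e M) = Suc (card M)"
proof -
  show "matching E (insert e M)"
    using assms(1-3) unfolding matching_def by (auto simp: pairwise_insert disjnt_def)
  have "e \<notin> M" using assms(3,4) by blast
  then show "card (insert e M) = Suc (card M)" using assms(5) by simp
qed

text \<open>Dropping the fourth edge of the six-vertex path detaches its last edge and leaves a path
  on four vertices.\<close>

lemma path_matching_6_imp_4:
  assumes "path_matching E 6 t" "finite E"
  shows "path_matching E 4 (t + 1)"
proof -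
  obtain p M where p: "inj_on p {..<6}" "\<And>i. Suc i < 6 \<Longrightarrow> {p i, p (Suc i)} \<in> E"
    and M: "matching E M" "card M = t" "p ` {..<6} \<inter> \<Union>M = {}"
    using assms(1) unfolding path_matching_def by blast
  have fin: "finite M" using M(1) assms(2) by (auto simp: matching_def intro: finite_subset)
  have sub: "{p 4, p 5} \<subseteq> p ` {..<6}" "p ` {..<4} \<subseteq> p ` {..<6}" by auto
  have disj: "p ` {..<4} \<inter> {p 4, p 5} = {}"
    by (auto simp: inj_on_eq_iff[OF p(1)])
  have "{p 4, p 5} \<in> E" using p(2)[of 4] by simp
  moreover have "{p 4, p 5} \<inter> \<Union>M = {}" using M(3) sub by blast
  ultimately have N: "matching E (insert {p 4, p 5} M)" "card (insert {p 4, p 5} M) = Suc t"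
    using matching_insert[OF M(1)] fin M(2) by auto
  show ?thesis
    unfolding path_matching_def
  proof (intro exI conjI allI impI)
    show "inj_on p {..<4}" using p(1) by (auto intro: inj_on_subset)
    show "{p i, p (Suc i)} \<in> E" if "Suc i < 4" for i using p(2) that by simp
    show "p ` {..<4} \<inter> \<Union>(insert {p 4, p 5} M) = {}" using M(3) sub(2) disj by blast
  qed (use N in auto)
qed

text \<open>The two end edges of the four-vertex path account for the summand 2.\<close>

lemma path_matching_4_imp_matching:
  assumes "path_matching E 4 s" "finite E"
  shows "\<exists>M. matching E M \<and> card M = s + 2"
proof -
  obtain p M where p: "inj_on p {..<4}" "\<And>i. Suc i < 4 \<Longrightarrow> {p i, p (Suc i)} \<in> E"
    and M: "matching E M" "card M = s" "p ` {..<4} \<inter> \<Union>M = {}"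
    using assms(1) unfolding path_matching_def by blast
  have fin: "finite M" using M(1) assms(2) by (auto simp: matching_def intro: finite_subset)
  have "p ` {..<4} = {p 0, p 1, p 2, p 3}" by (auto simp: numeral_nat lessThan_Suc)
  then have dis: "{p 2, p 3} \<inter> \<Union>M = {}" "{p 0, p 1} \<inter> \<Union>M = {}" using M(3) by auto
  have e: "{p 2, p 3} \<in> E" "{p 0, p 1} \<in> E" using p(2)[of 2] p(2)[of 0] by simp_all
  have "{p 0, p 1} \<inter> {p 2, p 3} = {}" by (simp add: inj_on_eq_iff[OF p(1)])
  then have disj: "{p 0, p 1} \<inter> \<Union>(insert {p 2, p 3} M) = {}" using dis by auto
  note 1 = matching_insert[OF M(1) e(1) dis(1) insert_not_empty fin]
  have "finite (insert {p 2, p 3} M)" using fin by simp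
  note 2 = matching_insert[OF 1(1) e(2) disj insert_not_empty this]
  from 1 2 M(2) have "matching E (insert {p 0, p 1} (insert {p 2, p 3} M))"
    "card (insert {p 0, p 1} (insert {p 2, p 3} M)) = s + 2" by simp_all
  then show ?thesis by blast
qed

lemma simple_graph_add_edge:
  "simple_graph G \<Longrightarrow> e \<in> edges (complement G) \<Longrightarrow> simple_graph (add_edge G e)"
  by (auto simp: simple_graph_def add_edge_def complement_def)

text \<open>Any one nontrivial component leads to the contradiction, so \<open>r\<close> may be an
  end of an arbitrary edge. The bound \<open>\<nu>\<close> is the true maximum and not
  \<open>t + 3\<close>, because the exchange arguments require that no matching is larger.\<close>

lemma matching_number_le:
  assumes G: "simple_graph G" and sat: "saturated (path 6 \<oplus> copies t (path 2)) G"
    and deg: "min_degree (nontrivial_part G) \<ge> 2"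
    and big: "\<And>C. C \<in> nontrivial_components G \<Longrightarrow> card (verts C) \<ge> 6"
    and book: "\<And>C m. C \<in> nontrivial_components G \<Longrightarrow> m \<ge> 1 \<Longrightarrow> \<not> isomorphic C (book m)"
    and fan: "\<And>C m. C \<in> nontrivial_components G \<Longrightarrow> m \<ge> 1 \<Longrightarrow> \<not> isomorphic C (fan m)"
    and M: "matching (edges G) M"
  shows "card M \<le> t + 2"
proof (rule ccontr)
  assume large: "\<not> card M \<le> t + 2"
  define \<nu> where "\<nu> = Max (card ` {M. matching (edges G) M})"
  interpret max_matchings "edges G" \<nu> unfolding \<nu>_def by (rule max_matchings_Max(1)[OF G])
  obtain M1 where M1: "mm M1"
    using max_matchings_Max(2)[OF G, folded \<nu>_def] by (auto simp: mm_def)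
  have t\<nu>: "t + 3 \<le> \<nu>" using card_le[OF M] large by simp
  have free: "\<not> path_matching (edges G) 6 t"
    using sat contains_copy_linear_forest[OF G, of 6 t] by (simp add: saturated_def)
  interpret no_alternating_P6 "edges G" \<nu>
  proof
    fix M a b c d e f
    assume "mm M" "{a, b} \<in> M" "{c, d} \<in> M" "{e, f} \<in> M" "{a, b} \<noteq> {c, d}" "{a, b} \<noteq> {e, f}"
      "{c, d} \<noteq> {e, f}" "{b, c} \<in> edges G" "{d, e} \<in> edges G"
    then show False using path_matching_alternating_P6[OF _ _ _ _ _ _ _ _ _ t\<nu>] free by blast
  next
    fix v x assume "{v, x} \<in> edges G"
    then show "\<exists>y. y \<noteq> x \<and> {v, y} \<in> edges G" by (rule min_degree_second_neighbour[OF G deg])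
  qed
  have "M \<noteq> {}" using large by auto
  then obtain e where e: "e \<in> edges G" using M by (auto simp: matching_def)
  then have "card e = 2" by (rule card_E)
  then obtain r z where rz: "{r, z} \<in> edges G" using e by (auto simp: card_2_iff)
  define S where "S = (adjacency G)\<^sup>* `` {r}"
  define C where "C = induced G S"
  have CN: "C \<in> nontrivial_components G" and vC: "verts C = S"
    using component_of_edge[OF G rz] by (auto simp: C_def S_def)
  have eC: "{x, y} \<in> edges C \<longleftrightarrow> {x, y} \<in> edges G" if "x \<in> S" "y \<in> S" for x y
    using that by (auto simp: C_def induced_def)
  have "finite (verts C)" using G by (simp add: C_def induced_def simple_graph_def)
  then have finS: "finite S" by (simp add: vC)
  have cardS: "card S \<ge> 6" using big[OF CN] vC by simp
  have step: "y \<in> S" if "x \<in> S" "{x, y} \<in> edges G" for x y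
    using that unfolding S_def by (rule reachable_step)
  have S: "S = {(u, v). {u, v} \<in> edges G}\<^sup>* `` {r}" by (simp add: S_def adjacency_def)
  from component_structure[OF M1 S cardS] show False
  proof (elim disjE bexE)
    fix b assume b: "b \<in> S" and fan_b: "\<forall>x. {b, x} \<in> edges G \<longrightarrow> (\<exists>y. y \<noteq> b \<and> y \<noteq> x \<and>
      {v. {x, v} \<in> edges G} = {b, y} \<and> {v. {y, v} \<in> edges G} = {b, x})"
    \<comment> \<open>\<open>s x\<close> is the third corner of the triangle through
      \<open>b\<close> and \<open>x\<close>, and serves as the involution of the fan.\<close>
    then obtain s where s: "\<And>x. {b, x} \<in> edges G \<Longrightarrow> s x \<noteq> b \<and> s x \<noteq> x \<and>
      {v. {x, v} \<in> edges G} = {b, s x} \<and> {v. {s x, v} \<in> edges G} = {b, x}" by metis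
    have bs: "{b, s x} \<in> edges G" "s (s x) = x" if "{b, x} \<in> edges G" for x
    proof -
      have "b \<in> {v. {s x, v} \<in> edges G}" using s[OF that] by blast
      then show bsx: "{b, s x} \<in> edges G" using E_sym by blast
      have "x \<noteq> b" using E_neq[OF that] by blast
      then show "s (s x) = x" using s[OF bsx] s[OF that] by (auto simp: doubleton_eq_iff)
    qed
    have "S \<subseteq> insert b {x. {b, x} \<in> edges G}"
      unfolding S_def reachable_eq[OF b[unfolded S_def], symmetric]
    proof (rule reachable_subset)
      fix x y assume "x \<in> insert b {x. {b, x} \<in> edges G}" "{x, y} \<in> edges G"
      then show "y \<in> insert b {x. {b, x} \<in> edges G}" using s[of x] bs(1)[of x] by blast
    qed simp
    then have star: "{b, x} \<in> edges G" if "x \<in> S" "x \<noteq> b" for x using that by blast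
    have "\<exists>m\<ge>1. isomorphic C (fan m)"
    proof (rule isomorphic_fan[where b = b and s = s])
      show "finite (verts C)" "b \<in> verts C" "card (verts C) \<ge> 2" using finS b cardS vC by auto
      show "s x \<in> verts C - {b} \<and> s x \<noteq> x \<and> s (s x) = x" if "x \<in> verts C - {b}" for x
      proof -
        have bx: "{b, x} \<in> edges G" using star that vC by blast
        then show ?thesis using s[OF bx] bs[OF bx] step[OF b] vC by blast
      qed
      show "{x, y} \<in> edges C \<longleftrightarrow> x \<noteq> y \<and> (x = b \<or> y = b \<or> y = s x)"
        if xy: "x \<in> verts C" "y \<in> verts C" for x y
      proof (cases "x = b")
        case True
        then show ?thesis using xy vC eC star[of y] E_neq[of b y] by auto
      next
        case False
        then have bx: "{b, x} \<in> edges G" using star xy vC by blast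
        have "{x, y} \<in> edges G \<longleftrightarrow> y \<in> {b, s x}" using s[OF bx] by blast
        then show ?thesis using False xy vC eC s[OF bx] by auto
      qed
    qed
    then show False using fan CN by blast
  next
    fix p q assume p: "p \<in> S" and q: "q \<in> S"
      and pq: "p \<noteq> q \<and> (\<forall>v\<in>S - {p, q}. {w. {v, w} \<in> edges G} = {p, q})"
    show False
    proof (cases "{p, q} \<in> edges G")
      case True
      have "\<exists>m\<ge>1. isomorphic C (book m)"
      proof (rule isomorphic_book[where p = p and q = q])
        show "finite (verts C)" "p \<in> verts C" "q \<in> verts C" "p \<noteq> q" "card (verts C) \<ge> 3"
          using finS p q pq cardS vC by auto
        fix x y assume "x \<in> verts C" "y \<in> verts C"
        then have xy: "x \<in> S" "y \<in> S" using vC by auto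
        have nb: "{v, w} \<in> edges G \<longleftrightarrow> w = p \<or> w = q" if "v \<in> S" "v \<noteq> p" "v \<noteq> q" for v w
          using pq that by blast
        have sy: "{x, y} \<in> edges G \<longleftrightarrow> {y, x} \<in> edges G" by (simp add: insert_commute)
        have pq': "{p, q} \<in> edges G" "{q, p} \<in> edges G" using True E_sym by blast+
        have ne: "{x, y} \<in> edges G \<Longrightarrow> x \<noteq> y" by (rule E_neq)
        show "{x, y} \<in> edges C \<longleftrightarrow> x \<noteq> y \<and> (x \<in> {p, q} \<or> y \<in> {p, q})"
          unfolding eC[OF xy] using nb[OF xy(1), of y] nb[OF xy(2), of x] sy pq' ne by blast
      qed
      then show False using book CN by blast
    next
      case False
      have "p \<in> verts G" "q \<in> verts G" using p q vC by (auto simp: C_def induced_def)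
      then have c: "{p, q} \<in> edges (complement G)" using False pq by (auto simp: complement_def)
      then have "contains_copy (add_edge G {p, q}) (path 6 \<oplus> copies t (path 2))"
        using sat by (simp add: saturated_def)
      then have "path_matching (insert {p, q} (edges G)) 6 t"
        using contains_copy_linear_forest[OF simple_graph_add_edge[OF G c], of 6 t]
        by (simp add: add_edge_def)
      then have "path_matching (edges G) 6 t"
      proof (rule path_matching_insert_edge)
        show "p \<in> S" "q \<in> S" "p \<noteq> q" "card S \<ge> 3" using p q pq cardS by auto
        show "{w. {v, w} \<in> edges G} = {p, q}" if "v \<in> S - {p, q}" for v using pq that by blast
      qed (use card_E step in auto)
      then show False using free by blast
    qed
  qed
qed

section \<open>The number of edges when an isolated vertex is present\<close>

lemma handshake:
  assumes "simple_graph G"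
  shows "(\<Sum>v\<in>\<Union>(edges G). card {e \<in> edges G. v \<in> e}) = 2 * card (edges G)"
proof -
  let ?E = "edges G"
  have fin: "finite ?E" using finite_edges[OF assms] .
  have finU: "finite (\<Union>?E)"
    using assms by (auto simp: simple_graph_def intro: finite_subset[of _ "verts G"])
  have "card {v \<in> \<Union>?E. v \<in> e} = 2" if "e \<in> ?E" for e
  proof -
    have "{v \<in> \<Union>?E. v \<in> e} = e" using that by auto
    then show ?thesis using assms that by (simp add: simple_graph_def)
  qed
  then have "(\<Sum>v\<in>\<Union>?E. card {e \<in> ?E. v \<in> e}) = (\<Sum>e\<in>?E. 2)"
    by (intro sum_multicount_gen finU fin ballI)
  then show ?thesis by simp
qed

lemma edges_lower_bound:
  assumes "simple_graph G" "\<And>v. v \<in> \<Union>(edges G) \<Longrightarrow> k \<le> card {e \<in> edges G. v \<in> e}"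
  shows "k * card (\<Union>(edges G)) \<le> 2 * card (edges G)"
  unfolding handshake[OF assms(1), symmetric]
  using sum_bounded_below[of "\<Union>(edges G)" k "\<lambda>v. card {e \<in> edges G. v \<in> e}"] assms(2)
  by (simp add: mult.commute)

text \<open>An isolated vertex \<open>w\<close> makes every vertex avoidable by a maximum matching, so
  non-adjacency is as in Gallai's lemma and the components are complete.\<close>

lemma adjacency_transitive:
  assumes G: "simple_graph G" and sat: "saturated (path 4 \<oplus> copies s (path 2)) G"
    and le: "\<And>M. matching (edges G) M \<Longrightarrow> card M \<le> s + 1"
    and w: "w \<in> verts G" "w \<notin> \<Union>(edges G)"
    and xy: "{x, y} \<in> edges G" and yz: "{y, z} \<in> edges G" and xz: "x \<noteq> z"
  shows "{x, z} \<in> edges G"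
proof (rule ccontr)
  assume nxz: "{x, z} \<notin> edges G"
  interpret max_matchings "edges G" "s + 1"
    by unfold_locales (use G finite_edges le in \<open>auto simp: simple_graph_def\<close>)
  \<comment> \<open>The copy in \<open>G\<close> plus \<open>{u, v}\<close> contains a matching of
    \<open>s + 2\<close> edges. This exceeds the bound for \<open>G\<close>, so the new edge is in
    it; removing that edge leaves a maximum matching of \<open>G\<close> missing both
    \<open>u\<close> and \<open>v\<close>.\<close>
  have free: "\<exists>M. mm M \<and> u \<notin> \<Union>M \<and> v \<notin> \<Union>M"
    if uv: "u \<in> verts G" "v \<in> verts G" "u \<noteq> v" "{u, v} \<notin> edges G" for u v
  proof -
    have c: "{u, v} \<in> edges (complement G)" using uv by (auto simp: complement_def)
    then have "contains_copy (add_edge G {u, v}) (path 4 \<oplus> copies s (path 2))"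
      using sat by (simp add: saturated_def)
    then have "path_matching (insert {u, v} (edges G)) 4 s"
      using contains_copy_linear_forest[OF simple_graph_add_edge[OF G c], of 4 s]
      by (simp add: add_edge_def)
    then obtain N where N: "matching (insert {u, v} (edges G)) N" "card N = s + 2"
      using path_matching_4_imp_matching finite_E by blast
    have uvN: "{u, v} \<in> N"
    proof (rule ccontr)
      assume "{u, v} \<notin> N"
      then have "matching (edges G) N" using N(1) by (auto simp: matching_def)
      then show False using le N(2) by fastforce
    qed
    have "finite N" using N(2) card.infinite by fastforce
    then have "card (N - {{u, v}}) = s + 1" using uvN N(2) by simp
    moreover have "matching (edges G) (N - {{u, v}})"
      using N(1) by (auto simp: matching_def pairwise_def)
    moreover have "u \<notin> \<Union>(N - {{u, v}})" "v \<notin> \<Union>(N - {{u, v}})"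
      using matching_same[OF N(1) _ uvN] by blast+
    ultimately show ?thesis unfolding mm_def by blast
  qed
  have V: "x \<in> verts G" "y \<in> verts G" "z \<in> verts G"
    using edge_verts[OF G xy] edge_verts[OF G yz] by auto
  obtain M1 where M1: "mm M1" "x \<notin> \<Union>M1" "z \<notin> \<Union>M1" using free[OF V(1,3) xz nxz] by blast
  \<comment> \<open>The isolated vertex is what supplies a non-neighbour of \<open>y\<close>, and
    thereby a maximum matching missing \<open>y\<close>.\<close>
  have "y \<noteq> w" "{y, w} \<notin> edges G" using w(2) xy by auto
  then obtain M2 where M2: "mm M2" "y \<notin> \<Union>M2" using free[OF V(2) w(1)] by blast
  show False using nonadjacent_unmatched[OF M1 xz M2 xy] yz by blast
qed

text \<open>Transitivity keeps everything reachable from \<open>v\<close> among \<open>v\<close> and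
  its neighbours.\<close>

lemma complete_component_degree:
  assumes G: "simple_graph G"
    and trans: "\<And>x y z. {x, y} \<in> edges G \<Longrightarrow> {y, z} \<in> edges G \<Longrightarrow> x \<noteq> z \<Longrightarrow> {x, z} \<in> edges G"
  shows "card ((adjacency G)\<^sup>* `` {v}) \<le> card {e \<in> edges G. v \<in> e} + 1"
proof -
  let ?N = "{w. {v, w} \<in> edges G}"
  have sub: "(adjacency G)\<^sup>* `` {v} \<subseteq> insert v ?N"
    by (rule reachable_subset) (use trans in auto)
  have inj: "inj_on (\<lambda>w. {v, w}) ?N" by (auto simp: inj_on_def doubleton_eq_iff)
  have fin: "finite {e \<in> edges G. v \<in> e}" using finite_edges[OF G] by simp
  have img: "(\<lambda>w. {v, w}) ` ?N \<subseteq> {e \<in> edges G. v \<in> e}" by auto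
  have finN: "finite ?N" using inj_on_finite[OF inj img fin] .
  have "card ((adjacency G)\<^sup>* `` {v}) \<le> card (insert v ?N)" by (rule card_mono) (use sub finN in auto)
  also have "\<dots> \<le> card ?N + 1" using finN by (simp add: card_insert_if)
  also have "card ?N \<le> card {e \<in> edges G. v \<in> e}" by (rule card_inj_on_le[OF inj img fin])
  finally show ?thesis by simp
qed

text \<open>A single component is complete on at least \<open>2 * t + 6\<close> vertices. Two
  components together have at least 12 vertices, all degrees being at least 5; this settles
  \<open>t = 1\<close> with 30 edges, and from \<open>t = 2\<close> on \<open>5 * t + 15\<close>
  already exceeds \<open>3 * t + 18\<close>.\<close>

lemma many_edges:
  assumes G: "simple_graph G" and t: "t \<ge> 1" and Q: "card (\<Union>(edges G)) \<ge> 2 * t + 6"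
    and big: "\<And>v. v \<in> \<Union>(edges G) \<Longrightarrow> card ((adjacency G)\<^sup>* `` {v}) \<ge> 6"
    and trans: "\<And>x y z. {x, y} \<in> edges G \<Longrightarrow> {y, z} \<in> edges G \<Longrightarrow> x \<noteq> z \<Longrightarrow> {x, z} \<in> edges G"
  shows "card (edges G) > 3 * t + 18"
proof -
  let ?Q = "\<Union>(edges G)" and ?R = "\<lambda>v. (adjacency G)\<^sup>* `` {v}"
  have deg: "card (?R v) \<le> card {e \<in> edges G. v \<in> e} + 1" for v
    by (rule complete_component_degree[OF G]) (rule trans)
  have finQ: "finite ?Q"
    using G by (auto simp: simple_graph_def intro: finite_subset[of _ "verts G"])
  have RQ: "?R v \<subseteq> ?Q" if "v \<in> ?Q" for v
    using that by (intro reachable_subset) auto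
  have "?Q \<noteq> {}" using Q by (metis add_is_0 card.empty le_zero_eq zero_neq_numeral)
  then obtain v where v: "v \<in> ?Q" by blast
  show ?thesis
  proof (cases "?R v = ?Q")
    case True
    have "2 * t + 5 \<le> card {e \<in> edges G. u \<in> e}" if "u \<in> ?Q" for u
    proof -
      have "?R u = ?Q" using reachable_eq that True by metis
      then show ?thesis using deg[of u] Q by simp
    qed
    then have "(2 * t + 5) * card ?Q \<le> 2 * card (edges G)" by (rule edges_lower_bound[OF G])
    \<comment> \<open>The factor 7 is \<open>2 * t + 5\<close> at \<open>t = 1\<close>; it makes the
      estimate linear and yields \<open>7 * t + 21\<close> edges.\<close>
    moreover have "7 * (2 * t + 6) \<le> (2 * t + 5) * card ?Q" using t Q by (intro mult_le_mono) auto
    ultimately have "7 * (2 * t + 6) \<le> 2 * card (edges G)" by (rule order_trans[rotated])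
    then show ?thesis by arith
  next
    case False
    then obtain u where u: "u \<in> ?Q" "u \<notin> ?R v" using RQ[OF v] by blast
    have disj: "?R u \<inter> ?R v = {}"
    proof (rule ccontr)
      assume "?R u \<inter> ?R v \<noteq> {}"
      then obtain x where "x \<in> ?R u" "x \<in> ?R v" by blast
      then have "?R u = ?R v" using reachable_eq by metis
      then show False using u(2) by blast
    qed
    have "card (?R u) + card (?R v) = card (?R u \<union> ?R v)"
      using RQ u(1) v finQ disj by (intro card_Un_disjoint[symmetric]) (auto intro: finite_subset)
    also have "\<dots> \<le> card ?Q" using RQ u(1) v finQ by (intro card_mono) auto
    finally have "12 \<le> card ?Q" using big[OF u(1)] big[OF v] by linarith
    moreover have "5 \<le> card {e \<in> edges G. u \<in> e}" if "u \<in> ?Q" for u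
      using deg[of u] big[OF that] by simp
    then have "5 * card ?Q \<le> 2 * card (edges G)" by (rule edges_lower_bound[OF G])
    ultimately show ?thesis using t Q by linarith
  qed
qed

theorem theorem2p6:
  fixes G :: "'a graph" and n t :: nat
  assumes "n \<ge> 1" and "t \<ge> 1"
    and "simple_graph G" and "card (verts G) = n"
    and "saturated (path 6 \<oplus> copies t (path 2)) G"
    and "card (verts (nontrivial_part G)) \<ge> 2 * t + 6"
    and "min_degree (nontrivial_part G) \<ge> 2"
    and "\<And>C. C \<in> nontrivial_components G \<Longrightarrow> card (verts C) \<ge> 6"
    and "\<And>C m. C \<in> nontrivial_components G \<Longrightarrow> m \<ge> 1 \<Longrightarrow> \<not> isomorphic C (book m)"
    and "\<And>C m. C \<in> nontrivial_components G \<Longrightarrow> m \<ge> 1 \<Longrightarrow> \<not> isomorphic C (fan m)"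
  shows "saturated (path 4 \<oplus> copies (t + 1) (path 2)) G \<and>
         ((\<exists>v. isolated G v) \<longrightarrow> card (edges G) > 3 * t + 18)"
proof (intro conjI impI)
  note G = \<open>simple_graph G\<close>
  have le: "card M \<le> t + 2" if "matching (edges G) M" for M
    using matching_number_le[OF G assms(5,7-10) that] .
  show sat: "saturated (path 4 \<oplus> copies (t + 1) (path 2)) G"
    unfolding saturated_def
  proof (intro conjI ballI notI)
    assume "contains_copy G (path 4 \<oplus> copies (t + 1) (path 2))"
    then have "path_matching (edges G) 4 (t + 1)" using contains_copy_linear_forest[OF G] by simp
    then obtain M where "matching (edges G) M" "card M = t + 1 + 2"
      using path_matching_4_imp_matching finite_edges[OF G] by blast
    then show False using le by fastforce
  next
    fix e assume e: "e \<in> edges (complement G)"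
    note Ge = simple_graph_add_edge[OF G e]
    have "contains_copy (add_edge G e) (path 6 \<oplus> copies t (path 2))"
      using assms(5) e by (simp add: saturated_def)
    \<comment> \<open>The old forest contains the new one, so the copy provided by the given
      saturation suffices.\<close>
    then have "path_matching (edges (add_edge G e)) 4 (t + 1)"
      using path_matching_6_imp_4 finite_edges[OF Ge] contains_copy_linear_forest[OF Ge] by simp
    then show "contains_copy (add_edge G e) (path 4 \<oplus> copies (t + 1) (path 2))"
      using contains_copy_linear_forest[OF Ge] by simp
  qed
  assume "\<exists>v. isolated G v"
  then obtain w where w: "w \<in> verts G" "degree G w = 0" by (auto simp: isolated_def)
  then have w': "w \<notin> \<Union>(edges G)" using finite_edges[OF G] by (auto simp: degree_def)
  show "card (edges G) > 3 * t + 18"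
  proof (rule many_edges[OF G assms(2)])
    show "card (\<Union>(edges G)) \<ge> 2 * t + 6" using assms(6) verts_nontrivial_part[OF G] by simp
    show "card ((adjacency G)\<^sup>* `` {v}) \<ge> 6" if v: "v \<in> \<Union>(edges G)" for v
    proof -
      obtain x where "{v, x} \<in> edges G" using v edge_doubleton[OF G] by blast
      from component_of_edge(1,2)[OF G this] show ?thesis using assms(8) by metis
    qed
    \<comment> \<open>Applied with \<open>s = t + 1\<close>, for which the required bound
      \<open>s + 1\<close> is \<open>t + 2\<close>.\<close>
    show "{x, z} \<in> edges G" if "{x, y} \<in> edges G" "{y, z} \<in> edges G" "x \<noteq> z" for x y z
      by (rule adjacency_transitive[OF G sat _ w(1) w' that]) (use le in simp)
  qed
qed

end
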